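(* Let $\alpha\in(0,1)$ and let $\{\sigma^{(\alpha)}_t,t\ge0\}$ be the $\alpha$-stable subordinator started from zero with $\mathbb{E}[e^{-\lambda\sigma^{(\alpha)}_t}]=e^{-t\lambda^\alpha}$ for all $t,\lambda\ge0$. For every $q>\alpha$, $$\int_0^\infty\frac{dt}{(1+\sigma^{(\alpha)}_t)^q}\;\stackrel{d}{=}\;\left(\frac{\Gamma(q-\alpha)}{\Gamma(q)}\right)\times\mathbf{T}\left(\frac{q}{q-\alpha},\frac{1}{q-\alpha},\frac{1-\alpha}{q-\alpha}\right).$$
   Context: For $a,b,c>0$, the infinite Beta product with parameters $a,b,c$ is the a.s. convergent product $\mathbf{T}(a,b,c)=\prod_{n=0}^\infty \frac{a+nb+c}{a+nb}\,\mathbf{B}_{a+nb,c}$ of independent factors, where $\mathbf{B}_{a,b}$ is a Beta random variable with density $\frac{\Gamma(a+b)}{\Gamma(a)\Gamma(b)}x^{a-1}(1-x)^{b-1}$ on $(0,1)$. $\stackrel{d}{=}$ is equality in law. *)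

theory Defs
  imports "HOL-Probability.Probability"
begin

text \<open>
  Processes are indexed by \<open>real\<close>, but only times \<open>t \<ge> 0\<close> are constrained. Path properties are
  required almost surely; a nondecreasing path automatically has left limits, so right-continuity
  makes it cadlag. As \<open>M\<close> need not be complete, path functionals such as time integrals are in
  general measurable only with respect to \<open>completion M\<close>.
\<close>

definition subordinator :: "'a measure \<Rightarrow> (real \<Rightarrow> 'a \<Rightarrow> real) \<Rightarrow> bool" where
  "subordinator M X \<longleftrightarrow>
     prob_space M \<and>
     (\<forall>t\<ge>0. X t \<in> borel_measurable M) \<and>
     (AE \<omega> in M. X 0 \<omega> = 0) \<and>
     (\<forall>(n::nat) t. 0 \<le> t 0 \<and> (\<forall>i<n. t i \<le> t (Suc i)) \<longrightarrow>
        prob_space.indep_vars M (\<lambda>_. borel) (\<lambda>i \<omega>. X (t (Suc i)) \<omega> - X (t i) \<omega>) {..<n}) \<and>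
     (\<forall>s\<ge>0. \<forall>t\<ge>0. distr M borel (\<lambda>\<omega>. X (s + t) \<omega> - X s \<omega>) = distr M borel (\<lambda>\<omega>. X t \<omega> - X 0 \<omega>)) \<and>
     (AE \<omega> in M. mono_on {0..} (\<lambda>t. X t \<omega>) \<and> (\<forall>t\<ge>0. continuous (at_right t) (\<lambda>s. X s \<omega>)))"

definition stable_subordinator :: "'a measure \<Rightarrow> real \<Rightarrow> (real \<Rightarrow> 'a \<Rightarrow> real) \<Rightarrow> bool" where
  "stable_subordinator M \<alpha> \<sigma> \<longleftrightarrow>
     subordinator M \<sigma> \<and>
     (\<forall>t\<ge>0. \<forall>l\<ge>0. prob_space.expectation M (\<lambda>\<omega>. exp (- l * \<sigma> t \<omega>)) = exp (- t * l powr \<alpha>))"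

definition beta_density :: "real \<Rightarrow> real \<Rightarrow> real \<Rightarrow> real" where
  "beta_density a b x =
     (if 0 < x \<and> x < 1
      then Gamma (a + b) / (Gamma a * Gamma b) * x powr (a - 1) * (1 - x) powr (b - 1)
      else 0)"

definition beta_distribution :: "real \<Rightarrow> real \<Rightarrow> real measure" where
  "beta_distribution a b = density lborel (\<lambda>x. ennreal (beta_density a b x))"

text \<open>
  The independent Beta variables are realised as the coordinates of a product space, so that
  \<open>beta_product a b c\<close> is a random variable on \<open>beta_space a b c\<close>. It is the limit of the partial
  products, which converge almost surely when \<open>a, b, c > 0\<close>.
\<close>

definition beta_space :: "real \<Rightarrow> real \<Rightarrow> real \<Rightarrow> (nat \<Rightarrow> real) measure" where
  "beta_space a b c = (\<Pi>\<^sub>M n\<in>UNIV. beta_distribution (a + real n * b) c)"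

definition beta_product :: "real \<Rightarrow> real \<Rightarrow> real \<Rightarrow> (nat \<Rightarrow> real) \<Rightarrow> real" where
  "beta_product a b c \<omega> =
     lim (\<lambda>N. \<Prod>n<N. (a + real n * b + c) / (a + real n * b) * \<omega> n)"

lemma prob_space_beta_distribution:
  assumes "a > 0" "b > 0"
  shows "prob_space (beta_distribution a b)"
proof
  have pos: "Gamma a > 0" "Gamma b > 0" "Gamma (a + b) > 0"
    using assms by (auto intro: Gamma_real_pos)
  define C where "C = Gamma (a + b) / (Gamma a * Gamma b)"
  have C: "C > 0" "C * Beta a b = 1"
    using pos by (auto simp: C_def Beta_def)
  have "((\<lambda>t. t powr (a - 1) * (1 - t) powr (b - 1)) has_integral Beta a b) {0..1}"
    using assms by (rule has_integral_Beta_real)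
  then have "((\<lambda>t. C * (t powr (a - 1) * (1 - t) powr (b - 1))) has_integral 1) {0..1}"
    using has_integral_mult_right[of _ "Beta a b" "{0..1}" C] C by simp
  then have hi: "((\<lambda>t. C * (t powr (a - 1) * (1 - t) powr (b - 1))) has_integral 1) {0<..<1}"
    by (simp add: has_integral_Icc_iff_Ioo)
  have bd: "beta_density a b = (\<lambda>x. if x \<in> {0<..<1} then C * (x powr (a - 1) * (1 - x) powr (b - 1)) else 0)"
    by (auto simp: beta_density_def C_def fun_eq_iff)
  have hi': "(beta_density a b has_integral 1) UNIV"
    using hi unfolding bd by (simp only: has_integral_restrict_UNIV)
  have meas: "beta_density a b \<in> borel_measurable borel"
    unfolding bd by measurable
  have "(\<integral>\<^sup>+x. ennreal (beta_density a b x) \<partial>lborel) = ennreal 1"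
    by (rule nn_integral_has_integral_lborel[OF meas _ hi']) (use C in \<open>auto simp: bd\<close>)
  then show "emeasure (beta_distribution a b) (space (beta_distribution a b)) = 1"
    using meas by (simp add: beta_distribution_def emeasure_density)
qed

end

(*
  Both laws have the moments n! * prod_{k=1..n} Gamma(k b) / Gamma(k b + alpha), where b = q - alpha.
  These are small enough compared with n! for the Taylor expansion of the characteristic function
  to converge everywhere, so the laws agree by Levy's uniqueness theorem.

  For the integral I, put A_s = int_0^s (1 + sigma_u)^(-q) du. Expanding
  A_s^(m+1) = (m+1) int_0^s (1 + sigma_u)^(-q) A_u^m du and applying the Markov property at time u,
  where (1 + sigma_s)^(-p) is a Gamma mixture of exponentials, gives for
  G(m, p) = E int_0^infinity A_s^m (1 + sigma_s)^(-p) ds the recursion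
  G(m+1, p) = (m+1) * Gamma(p - alpha) / Gamma(p) * G(m, p + b), and E I^(m+1) = (m+1) G(m, q).

  For the Beta product, the moments of the partial products are products of Gamma quotients that
  converge by the Gamma limit formula. Almost sure convergence follows from the summability of the
  weighted squared increments along N = k^3; between two cubes the products of the Beta variables decrease
  while their deterministic normalisation varies by a factor tending to 1.
*)

theory Submission imports Defs begin

section \<open>Beta products\<close>

text \<open>Moments with a general exponent \<open>p\<close> are needed because the Markov property
  at time \<open>u\<close> turns \<open>(1 + \<sigma>_s)^(-p)\<close> into
  \<open>(1 + \<sigma>_u)^(-(p - \<alpha>))\<close>, which merges with
  \<open>(1 + \<sigma>_u)^(-q)\<close>: the family is closed under the recursion only if
  \<open>p\<close> may move. The drop by \<alpha> comes from
  \<open>int_0^infinity exp(-t l^\<alpha>) dt = l^(-\<alpha>)\<close>, which lowers the power of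
  \<open>l\<close> in the Gamma mixture. Integrals are taken in the extended nonnegative reals, so
  Tonelli's theorem applies before any moment is known to be finite. Independence is given for
  finitely many increments only, while \<open>A_u\<close> depends on the whole path up to
  \<open>u\<close>; hence the sampling on a grid. The Beta factors are scaled to mean 1, so the
  partial products form a martingale with orthogonal increments. A single increment has L2 norm of
  order \<open>1/N\<close>, too large to be summed over all \<open>N\<close>. The roughly
  \<open>3 k^2\<close> increments between consecutive cubes near \<open>k^3\<close> have together a
  second moment of order \<open>k^(-4)\<close>, which stays summable after the weight
  \<open>k^2\<close>.\<close>

lemma beta_density_nonneg: "0 < a \<Longrightarrow> 0 < b \<Longrightarrow> 0 \<le> beta_density a b x"
  by (simp add: beta_density_def Gamma_real_pos less_imp_le)

lemma borel_measurable_beta_density [measurable]: "beta_density a b \<in> borel_measurable borel"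
  unfolding beta_density_def by measurable

lemma sets_beta_distribution [measurable_cong, simp]: "sets (beta_distribution a b) = sets borel"
  by (simp add: beta_distribution_def)

lemma borel_measurable_beta_distribution [simp]:
  "borel_measurable (beta_distribution a b) = borel_measurable borel"
  by (rule measurable_cong_sets) simp_all

lemma space_beta_distribution [simp]: "space (beta_distribution a b) = UNIV"
  by (simp add: beta_distribution_def)

lemma AE_beta_distribution: "AE x in beta_distribution a b. 0 < x \<and> x < 1"
  unfolding beta_distribution_def
  by (subst AE_density) (auto simp: beta_density_def)

text \<open>Multiplying the density by \<open>x ^ k\<close> gives a multiple of the Beta density
  with first parameter \<open>a + k\<close>, which has mass 1; the multiple is a quotient of Gamma
  values, that is, of Pochhammer symbols.\<close>

lemma nn_integral_beta_moment:
  assumes "a > 0" "b > 0"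
  shows "(\<integral>\<^sup>+x. ennreal (x ^ k) \<partial>beta_distribution a b) = ennreal (pochhammer a k / pochhammer (a + b) k)"
proof -
  define r where "r = pochhammer a k / pochhammer (a + b) k"
  have "r \<ge> 0"
    using assms by (simp add: r_def pochhammer_nonneg)
  have nI: "a \<notin> \<int>\<^sub>\<le>\<^sub>0" "a + b \<notin> \<int>\<^sub>\<le>\<^sub>0"
    using assms by (auto elim!: nonpos_Ints_cases)
  have pos: "Gamma a > 0" "Gamma b > 0" "Gamma (a + b) > 0" "Gamma (a + k) > 0" "Gamma (a + b + k) > 0"
    using assms by (auto intro!: Gamma_real_pos)
  have r: "r = Gamma (a + k) / Gamma a * (Gamma (a + b) / Gamma (a + b + k))"
    using nI by (simp add: r_def pochhammer_Gamma)
  have eq0: "beta_density a b x * x ^ k = r * beta_density (a + k) b x" for x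
  proof (cases "0 < x \<and> x < 1")
    case True
    then have "x powr (a + k - 1) = x powr (a - 1) * x ^ k"
      using powr_add[of x "a - 1" k] by (simp add: powr_realpow algebra_simps)
    moreover have "Gamma (a + k + b) = Gamma (a + b + k)"
      by (simp add: add_ac)
    ultimately show ?thesis
      using pos True by (simp add: beta_density_def r field_simps)
  qed (auto simp: beta_density_def)
  have eq: "ennreal (beta_density a b x) * ennreal (x ^ k) = ennreal r * ennreal (beta_density (a + k) b x)" for x
    unfolding ennreal_mult'[OF beta_density_nonneg[OF assms], symmetric] ennreal_mult'[OF \<open>r \<ge> 0\<close>, symmetric] eq0 ..
  interpret prob_space "beta_distribution (a + k) b"
    using assms by (intro prob_space_beta_distribution) auto
  have "(\<integral>\<^sup>+x. ennreal (beta_density (a + k) b x) \<partial>lborel) = 1"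
    using emeasure_space_1 by (simp add: beta_distribution_def emeasure_density)
  then show ?thesis
    by (simp add: beta_distribution_def nn_integral_density eq nn_integral_cmult flip: r_def)
qed

locale beta_factors =
  fixes a b c :: real
  assumes pos: "a > 0" "b > 0" "c > 0"
begin

abbreviation "index n \<equiv> a + real n * b"

lemma index_pos [simp]: "index n > 0"
  using pos by (simp add: add_pos_nonneg)

sublocale product_prob_space "\<lambda>n. beta_distribution (index n) c" UNIV
proof -
  interpret prob_space "beta_distribution (index n) c" for n
    using pos by (intro prob_space_beta_distribution) auto
  show "product_prob_space (\<lambda>n. beta_distribution (index n) c)"
    by unfold_locales
qed

abbreviation "S \<equiv> beta_space a b c"

lemma prob_space_S: "prob_space S"
  unfolding beta_space_def by unfold_locales

text \<open>The reciprocal of the mean of the n-th Beta variable, so that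
  \<open>ratio n * \<omega> n\<close> has mean 1 and \<open>partial\<close> is a martingale.\<close>

definition ratio :: "nat \<Rightarrow> real" where "ratio n = (index n + c) / index n"

definition partial :: "nat \<Rightarrow> (nat \<Rightarrow> real) \<Rightarrow> real" where "partial N \<omega> = (\<Prod>n<N. ratio n * \<omega> n)"

definition factor_moment :: "nat \<Rightarrow> nat \<Rightarrow> real" where
  "factor_moment n k = ratio n ^ k * (pochhammer (index n) k / pochhammer (index n + c) k)"

lemma ratio_pos [simp]: "ratio n > 0"
  using pos by (simp add: ratio_def add_pos_pos)

lemma AE_S: "AE \<omega> in S. \<forall>n. 0 < \<omega> n \<and> \<omega> n < 1"
  unfolding AE_all_countable beta_space_def
  by (intro allI AE_component AE_beta_distribution) auto

lemma measurable_coordinate [measurable]: "(\<lambda>\<omega>. \<omega> n) \<in> borel_measurable S"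
  unfolding beta_space_def by measurable

lemma measurable_partial [measurable]: "partial N \<in> borel_measurable S"
  unfolding partial_def by measurable

lemma factor_moment_nonneg: "0 \<le> factor_moment n k"
  using pos index_pos[of n] ratio_pos[of n] unfolding factor_moment_def
  by (intro mult_nonneg_nonneg divide_nonneg_nonneg pochhammer_nonneg zero_le_power) linarith+

lemma nn_integral_factor:
  "(\<integral>\<^sup>+x. ennreal ((ratio n * x) ^ k) \<partial>beta_distribution (index n) c) = ennreal (factor_moment n k)"
proof -
  have "(\<integral>\<^sup>+x. ennreal ((ratio n * x) ^ k) \<partial>beta_distribution (index n) c)
      = (\<integral>\<^sup>+x. ennreal (ratio n ^ k) * ennreal (x ^ k) \<partial>beta_distribution (index n) c)"
    by (intro nn_integral_cong) (simp add: power_mult_distrib ennreal_mult' less_imp_le)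
  also have "\<dots> = ennreal (ratio n ^ k) * ennreal (pochhammer (index n) k / pochhammer (index n + c) k)"
    using pos by (subst nn_integral_cmult) (simp_all add: nn_integral_beta_moment)
  finally show ?thesis
    unfolding factor_moment_def by (subst ennreal_mult') (auto simp: less_imp_le)
qed

text \<open>Only finitely many coordinates enter, so the integral can be taken over a finite
  product, where it splits. The exponent may depend on the factor so that mixed moments of two
  partial products of different lengths are covered as well.\<close>

lemma nn_integral_factors:
  "(\<integral>\<^sup>+\<omega>. ennreal (\<Prod>n<N. (ratio n * \<omega> n) ^ k n) \<partial>S) = ennreal (\<Prod>n<N. factor_moment n (k n))"
proof -
  let ?f = "\<lambda>n x. ennreal ((ratio n * x) ^ k n)"
  have m: "(\<lambda>x. ?f n (x n)) \<in> borel_measurable (\<Pi>\<^sub>M n\<in>{..<N}. beta_distribution (index n) c)" if "n < N" for n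
    by (rule measurable_compose[OF measurable_component_singleton]) (use that in simp_all)
  have mp: "(\<lambda>x. \<Prod>n<N. ?f n (x n)) \<in> borel_measurable (\<Pi>\<^sub>M n\<in>{..<N}. beta_distribution (index n) c)"
    by (rule borel_measurable_prod_ennreal, rule m, simp)
  have "(\<integral>\<^sup>+\<omega>. ennreal (\<Prod>n<N. (ratio n * \<omega> n) ^ k n) \<partial>S) = (\<integral>\<^sup>+\<omega>. (\<Prod>n<N. ?f n (\<omega> n)) \<partial>S)"
    using AE_S by (intro nn_integral_cong_AE) (auto simp: prod_ennreal less_imp_le)
  also have "\<dots> = (\<integral>\<^sup>+\<omega>. (\<Prod>n<N. ?f n (restrict \<omega> {..<N} n)) \<partial>S)"
    by (intro nn_integral_cong prod.cong) auto
  also have "\<dots> = (\<integral>\<^sup>+x. (\<Prod>n<N. ?f n (x n)) \<partial>distr S (\<Pi>\<^sub>M n\<in>{..<N}. beta_distribution (index n) c) (\<lambda>\<omega>. restrict \<omega> {..<N}))"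
    unfolding beta_space_def
    by (subst nn_integral_distr) (simp_all add: mp measurable_restrict_subset)
  also have "\<dots> = (\<integral>\<^sup>+x. (\<Prod>n<N. ?f n (x n)) \<partial>(\<Pi>\<^sub>M n\<in>{..<N}. beta_distribution (index n) c))"
    unfolding beta_space_def by (simp add: distr_PiM_restrict_finite)
  also have "\<dots> = (\<Prod>n<N. ennreal (factor_moment n (k n)))"
    by (subst product_nn_integral_prod) (auto simp: nn_integral_factor)
  finally show ?thesis
    by (simp add: prod_ennreal factor_moment_nonneg)
qed

lemma has_bochner_integral_factors:
  "has_bochner_integral S (\<lambda>\<omega>. \<Prod>n<N. (ratio n * \<omega> n) ^ k n) (\<Prod>n<N. factor_moment n (k n))"
  using AE_S
  by (intro has_bochner_integral_nn_integral nn_integral_factors prod_nonneg factor_moment_nonneg)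
     (auto intro!: prod_nonneg simp: less_imp_le)

lemma has_bochner_integral_partial_power:
  "has_bochner_integral S (\<lambda>\<omega>. partial N \<omega> ^ k) (\<Prod>n<N. factor_moment n k)"
  using has_bochner_integral_factors[where N=N and k="\<lambda>_. k"] by (simp add: partial_def prod_power_distrib)

text \<open>Orthogonality of martingale increments: the factors from \<open>N\<close> on have mean
  1, so the mixed moment of \<open>partial N\<close> and \<open>partial N'\<close> equals the second
  moment of \<open>partial N\<close>.\<close>

lemma partial_increment_square:
  assumes "N \<le> N'"
  shows "has_bochner_integral S (\<lambda>\<omega>. (partial N' \<omega> - partial N \<omega>)\<^sup>2)
    ((\<Prod>n<N'. factor_moment n 2) - (\<Prod>n<N. factor_moment n 2))"
proof -
  have fm1: "factor_moment n 1 = 1" for n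
    using pos index_pos[of n] add_pos_pos[OF index_pos[of n] pos(3)]
    by (simp add: factor_moment_def ratio_def del: index_pos)
  have split: "(\<Prod>n<N'. f n) = (\<Prod>n<N. f n) * (\<Prod>n\<in>{N..<N'}. f n)" for f :: "nat \<Rightarrow> real"
    using assms by (subst prod.union_disjoint[symmetric]) (auto simp: ivl_disj_un_one)
  \<comment> \<open>These exponents encode the mixed moment: the factors common to both partial
    products occur twice, the later ones once.\<close>
  define k where "k n = (if n < N then 2 else 1 :: nat)" for n
  have 1: "(\<Prod>n<N'. (ratio n * \<omega> n) ^ k n) = partial N \<omega> * partial N' \<omega>" for \<omega>
    by (auto simp: k_def split partial_def power2_eq_square prod.distrib)
  have 2: "(\<Prod>n<N'. factor_moment n (k n)) = (\<Prod>n<N. factor_moment n 2)"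
    using fm1 by (simp add: k_def split)
  have 3: "has_bochner_integral S (\<lambda>\<omega>. partial N \<omega> * partial N' \<omega>) (\<Prod>n<N. factor_moment n 2)"
    using has_bochner_integral_factors[where N=N' and k=k] unfolding 1 2 .
  have "has_bochner_integral S (\<lambda>\<omega>. partial N' \<omega> ^ 2 + partial N \<omega> ^ 2 - 2 * (partial N \<omega> * partial N' \<omega>))
    ((\<Prod>n<N'. factor_moment n 2) + (\<Prod>n<N. factor_moment n 2) - 2 * (\<Prod>n<N. factor_moment n 2))"
    by (intro has_bochner_integral_diff has_bochner_integral_add has_bochner_integral_partial_power
         has_bochner_integral_mult_right 3)
  then show ?thesis
    by (simp add: power2_diff algebra_simps)
qed

end

section \<open>Almost sure convergence of the partial products\<close>

lemma summable_inverse_squares_Suc: "summable (\<lambda>n. 1 / (real n + 1)\<^sup>2)"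
proof -
  have "summable (\<lambda>n. inverse ((real n)\<^sup>2))"
    by (rule inverse_power_summable) simp
  then have "summable (\<lambda>n. inverse ((real (Suc n))\<^sup>2))"
    by (subst summable_Suc_iff)
  then show ?thesis
    by (simp add: inverse_eq_divide add_ac)
qed

context beta_factors begin

lemma index_ge: "min a b * (real n + 1) \<le> index n"
proof -
  have "min a b \<le> a" "real n * min a b \<le> real n * b"
    by (auto intro!: mult_left_mono)
  then show ?thesis by (simp add: algebra_simps del: min_le_iff_disj min.absorb_iff1 min.absorb_iff2)
qed

text \<open>As the factor has mean 1, the second summand is its variance; it decays like
  \<open>1 / n^2\<close>, and this rate governs the almost sure convergence.\<close>

lemma factor_moment_2: "factor_moment n 2 = 1 + c / (index n * (index n + c + 1))"
proof -
  define x y where "x = index n" and "y = index n + c"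
  have "x > 0" "y > 0" "c = y - x" 
    unfolding x_def y_def using pos index_pos[of n] by linarith+
  moreover have "(y / x)\<^sup>2 * (x * (x + 1) / (y * (y + 1))) = 1 + (y - x) / (x * (y + 1))" if "x > 0" "y > 0" for x y :: real
    using that by (simp add: divide_simps add_pos_pos) (simp add: power2_eq_square algebra_simps)
  ultimately show ?thesis
    unfolding factor_moment_def ratio_def x_def[symmetric] y_def[symmetric]
    by (simp add: pochhammer_Suc numeral_2_eq_2)
qed

lemma factor_moment_2_le:
  obtains C where "C > 0" "\<And>n. factor_moment n 2 - 1 \<le> C / (real n + 1)\<^sup>2"
proof
  define m where "m = min a b"
  have m: "m > 0" using pos by (simp add: m_def)
  show "c / m\<^sup>2 > 0" using pos m by simp
  fix n
  have "m * (real n + 1) \<le> index n" unfolding m_def by (rule index_ge)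
  then have "m * (real n + 1) * (m * (real n + 1)) \<le> index n * (index n + c + 1)"
    using m pos index_pos[of n] by (intro mult_mono) (linarith | simp del: index_pos)+
  then have "c / (index n * (index n + c + 1)) \<le> c / (m * (real n + 1) * (m * (real n + 1)))"
    using m pos index_pos[of n] by (intro divide_left_mono mult_pos_pos) (linarith | simp del: index_pos)+
  also have "\<dots> = c / m\<^sup>2 / (real n + 1)\<^sup>2"
    by (simp add: power2_eq_square)
  finally show "factor_moment n 2 - 1 \<le> c / m\<^sup>2 / (real n + 1)\<^sup>2"
    by (simp add: factor_moment_2)
qed

lemma factor_moment_2_ge: "1 \<le> factor_moment n 2"
proof -
  have "0 < index n * (index n + c + 1)"
    using pos index_pos[of n] by (intro mult_pos_pos) linarith+
  then show ?thesis using pos unfolding factor_moment_2 by simp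
qed

text \<open>The bound \<open>1 + x \<le> exp x\<close> turns the product of second moments into the
  exponential of a convergent sum, so all of them stay below one constant \<open>B\<close>. Each of
  the \<open>N' - N\<close> steps then adds at most
  \<open>B * C / (real N + 1)\<^sup>2\<close>.\<close>

lemma second_moment_increment:
  obtains K where "K > 0" "\<And>N N'. N \<le> N' \<Longrightarrow>
    (\<Prod>n<N'. factor_moment n 2) - (\<Prod>n<N. factor_moment n 2) \<le> K * (real N' - real N) / (real N + 1)\<^sup>2"
proof -
  obtain C where C: "C > 0" "\<And>n. factor_moment n 2 - 1 \<le> C / (real n + 1)\<^sup>2"
    using factor_moment_2_le by blast
  define E where "E N = (\<Prod>n<N. factor_moment n 2)" for N
  define B where "B = exp (C * (\<Sum>n. 1 / (real n + 1)\<^sup>2))"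
  have sm: "summable (\<lambda>n. 1 / (real n + 1)\<^sup>2)"
    by (rule summable_inverse_squares_Suc)
  have E: "E N \<le> B" for N
  proof -
    have "E N \<le> (\<Prod>n<N. exp (C * (1 / (real n + 1)\<^sup>2)))"
      unfolding E_def
    proof (intro prod_mono conjI factor_moment_nonneg)
      fix n
      have "factor_moment n 2 \<le> 1 + C * (1 / (real n + 1)\<^sup>2)" using C(2)[of n] by simp
      then show "factor_moment n 2 \<le> exp (C * (1 / (real n + 1)\<^sup>2))"
        using exp_ge_add_one_self order_trans by blast
    qed
    also have "\<dots> = exp (C * (\<Sum>n<N. 1 / (real n + 1)\<^sup>2))"
      by (simp add: exp_sum sum_distrib_left)
    also have "\<dots> \<le> B"
      unfolding B_def using C(1) sm by (auto intro!: sum_le_suminf)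
    finally show ?thesis .
  qed
  have "E N' - E N \<le> B * C * (real N' - real N) / (real N + 1)\<^sup>2" if "N \<le> N'" for N N'
  proof -
    have "E N' - E N = (\<Sum>n\<in>{N..<N'}. E (Suc n) - E n)"
      using that by (simp add: sum_Suc_diff')
    also have "\<dots> \<le> (\<Sum>n\<in>{N..<N'}. B * C / (real N + 1)\<^sup>2)"
    proof (rule sum_mono)
      fix n assume n: "n \<in> {N..<N'}"
      have "E (Suc n) - E n = E n * (factor_moment n 2 - 1)"
        by (simp add: E_def algebra_simps)
      also have "\<dots> \<le> B * (C / (real N + 1)\<^sup>2)"
      proof (rule mult_mono)
        have "C / (real n + 1)\<^sup>2 \<le> C / (real N + 1)\<^sup>2"
          using C(1) n by (intro divide_left_mono power_mono mult_pos_pos zero_less_power) auto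
        then show "factor_moment n 2 - 1 \<le> C / (real N + 1)\<^sup>2"
          using C(2)[of n] by linarith
      qed (use E factor_moment_2_ge in \<open>auto simp: B_def\<close>)
      finally show "E (Suc n) - E n \<le> B * C / (real N + 1)\<^sup>2" by simp
    qed
    finally show ?thesis using that by (simp add: of_nat_diff mult_ac)
  qed
  moreover have "B * C > 0" using C by (simp add: B_def)
  ultimately show ?thesis using that unfolding E_def by blast
qed

lemma cube_gap: "real ((k + 2) ^ 3) - real ((k + 1) ^ 3) \<le> 7 * (real k + 1)\<^sup>2"
proof -
  have "real k \<ge> 0" by simp
  then show ?thesis by (simp add: power2_eq_square power3_eq_cube algebra_simps)
qed

text \<open>Along the cubes the second moments of the increments are small enough for almost sure absolute summability;
  the factors between two consecutive cubes are controlled by their deterministic part.\<close>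

lemma AE_convergent_partial_cubes: "AE \<omega> in S. convergent (\<lambda>k. partial ((k + 1) ^ 3) \<omega>)"
proof -
  define D where "D k \<omega> = partial ((k + 2) ^ 3) \<omega> - partial ((k + 1) ^ 3) \<omega>" for k \<omega>
  obtain K where K: "K > 0" "\<And>N N'. N \<le> N' \<Longrightarrow>
    (\<Prod>n<N'. factor_moment n 2) - (\<Prod>n<N. factor_moment n 2) \<le> K * (real N' - real N) / (real N + 1)\<^sup>2"
    using second_moment_increment by blast
  have sm: "summable (\<lambda>n. 1 / (real n + 1)\<^sup>2)"
    by (rule summable_inverse_squares_Suc)
  have [measurable]: "D k \<in> borel_measurable S" for k
    unfolding D_def by measurable
  \<comment> \<open>The second moment of \<open>D k\<close> is at most
    \<open>7 * K / (k + 1)^4\<close>: a gap of at most \<open>7 * (k + 1)^2\<close> over the square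
    of \<open>(k + 1)^3\<close>. Half of the decay pays for the weight, the other half keeps the sum
    finite.\<close>
  have D: "(\<integral>\<^sup>+\<omega>. ennreal ((real k + 1)\<^sup>2 * (D k \<omega>)\<^sup>2) \<partial>S) \<le> ennreal (7 * K * (1 / (real k + 1)\<^sup>2))" for k
  proof -
    let ?N = "(k + 1) ^ 3" and ?N' = "(k + 2) ^ 3"
    have le: "?N \<le> ?N'" by (rule power_mono) auto
    let ?d = "(\<Prod>n<?N'. factor_moment n 2) - (\<Prod>n<?N. factor_moment n 2)"
    have "(\<integral>\<^sup>+\<omega>. ennreal ((real k + 1)\<^sup>2 * (D k \<omega>)\<^sup>2) \<partial>S) = ennreal ((real k + 1)\<^sup>2 * ?d)"
      unfolding D_def using partial_increment_square[OF le]
      by (intro has_bochner_integral_iff[THEN iffD1, THEN conjunct2, THEN eq_refl, THEN antisym] nn_integral_eq_integral[THEN trans]) (auto simp: has_bochner_integral_iff)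
    also have "(real k + 1)\<^sup>2 * ?d \<le> (real k + 1)\<^sup>2 * (K * (7 * (real k + 1)\<^sup>2) / ((real k + 1) ^ 3)\<^sup>2)"
    proof (rule mult_left_mono)
      have "?d \<le> K * (real ?N' - real ?N) / (real ?N + 1)\<^sup>2" by (rule K(2)[OF le])
      also have "\<dots> \<le> K * (7 * (real k + 1)\<^sup>2) / ((real k + 1) ^ 3)\<^sup>2"
        using K(1) cube_gap[of k] le
        by (intro frac_le mult_left_mono power_mono mult_nonneg_nonneg) (auto simp: add_ac)
      finally show "?d \<le> \<dots>" .
    qed simp
    also have "\<dots> = 7 * K * (1 / (real k + 1)\<^sup>2)"
    proof -
      have "y\<^sup>2 * (K * (7 * y\<^sup>2) / (y ^ 3)\<^sup>2) = 7 * K * (1 / y\<^sup>2)" if "y > 0" for y :: real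
        using that by (simp add: field_simps eval_nat_numeral)
      then show ?thesis by simp
    qed
    finally show ?thesis by (simp add: ennreal_leI)
  qed
  have "(\<integral>\<^sup>+\<omega>. (\<Sum>k. ennreal ((real k + 1)\<^sup>2 * (D k \<omega>)\<^sup>2)) \<partial>S) = (\<Sum>k. \<integral>\<^sup>+\<omega>. ennreal ((real k + 1)\<^sup>2 * (D k \<omega>)\<^sup>2) \<partial>S)"
    by (rule nn_integral_suminf) measurable
  also have "\<dots> \<le> (\<Sum>k. ennreal (7 * K * (1 / (real k + 1)\<^sup>2)))"
    by (intro suminf_le D) auto
  also have "\<dots> = ennreal (\<Sum>k. 7 * K * (1 / (real k + 1)\<^sup>2))"
    using K sm by (intro suminf_ennreal2 summable_mult) auto
  finally have fin: "(\<integral>\<^sup>+\<omega>. (\<Sum>k. ennreal ((real k + 1)\<^sup>2 * (D k \<omega>)\<^sup>2)) \<partial>S) \<noteq> \<infinity>"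
    by (auto simp: top_unique)
  have "AE \<omega> in S. (\<Sum>k. ennreal ((real k + 1)\<^sup>2 * (D k \<omega>)\<^sup>2)) \<noteq> \<infinity>"
    by (rule nn_integral_PInf_AE[OF _ fin]) measurable
  then show ?thesis
  proof eventually_elim
    case (elim \<omega>)
    then have "summable (\<lambda>k. (real k + 1)\<^sup>2 * (D k \<omega>)\<^sup>2)"
      by (intro summable_suminf_not_top) auto
    then have s: "summable (\<lambda>k. 1 / (real k + 1)\<^sup>2 + (real k + 1)\<^sup>2 * (D k \<omega>)\<^sup>2)"
      using sm by (rule summable_add[rotated])
    \<comment> \<open>The inequality \<open>2 x y \<le> x^2 + y^2\<close> with
      \<open>x = 1 / (k + 1)\<close> and \<open>y = (k + 1) * \<bar>D k \<omega>\<bar>\<close>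
      explains the weight chosen above: both squares are summable.\<close>
    have "norm (D k \<omega>) \<le> 1 / (real k + 1)\<^sup>2 + (real k + 1)\<^sup>2 * (D k \<omega>)\<^sup>2" for k
    proof -
      have "2 * (1 / (real k + 1)) * ((real k + 1) * \<bar>D k \<omega>\<bar>) \<le> (1 / (real k + 1))\<^sup>2 + ((real k + 1) * \<bar>D k \<omega>\<bar>)\<^sup>2"
        by (rule sum_squares_bound)
      moreover have "2 * (1 / (real k + 1)) * ((real k + 1) * \<bar>D k \<omega>\<bar>) = 2 * \<bar>D k \<omega>\<bar>"
        by (simp add: field_simps)
      ultimately show ?thesis
        by (simp add: power_mult_distrib power_divide)
    qed
    then have "summable (\<lambda>k. D k \<omega>)"
      using s by (intro summable_comparison_test'[OF s, of 0]) auto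
    then have "convergent (\<lambda>n. (\<Sum>k<n. D k \<omega>) + partial 1 \<omega>)"
      by (intro convergent_add convergent_const) (simp add: summable_iff_convergent)
    moreover have "(\<Sum>k<n. D k \<omega>) + partial 1 \<omega> = partial ((n + 1) ^ 3) \<omega>" for n
      using sum_lessThan_telescope[of "\<lambda>k. partial ((k + 1) ^ 3) \<omega>" n] by (simp add: D_def)
    ultimately show ?case by simp
  qed
qed

text \<open>A block between cubes has at most \<open>7 * (k + 1)^2\<close> factors, each at most
  \<open>1 + c / (m * (k + 1)^3)\<close>, so the product is at most the exponential of a multiple of
  \<open>1 / (k + 1)\<close>.\<close>

lemma block_ratio_tendsto: "(\<lambda>k. \<Prod>n\<in>{(k + 1) ^ 3..<(k + 2) ^ 3}. ratio n) \<longlonglongrightarrow> 1"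
proof (rule tendsto_sandwich)
  define m where "m = min a b"
  have m: "m > 0" using pos by (simp add: m_def)
  have ratio1: "1 \<le> ratio n" for n
    using pos index_pos[of n] by (simp add: ratio_def del: index_pos)
  show "\<forall>\<^sub>F k in sequentially. 1 \<le> (\<Prod>n\<in>{(k + 1) ^ 3..<(k + 2) ^ 3}. ratio n)"
    by (intro always_eventually allI prod_ge_1 ratio1)
  show "\<forall>\<^sub>F k in sequentially. (\<Prod>n\<in>{(k + 1) ^ 3..<(k + 2) ^ 3}. ratio n) \<le> exp (7 * c / m * (1 / (real k + 1)))"
  proof (intro always_eventually allI)
    fix k
    have "(\<Prod>n\<in>{(k + 1) ^ 3..<(k + 2) ^ 3}. ratio n) \<le> (\<Prod>n\<in>{(k + 1) ^ 3..<(k + 2) ^ 3}. exp (c / (m * (real k + 1) ^ 3)))"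
    proof (intro prod_mono conjI)
      fix n assume n: "n \<in> {(k + 1) ^ 3..<(k + 2) ^ 3}"
      have "real ((k + 1) ^ 3) \<le> real n" using n by (simp only: of_nat_le_iff) auto
      then have "m * (real k + 1) ^ 3 \<le> m * (real n + 1)" using m by (simp add: add_ac)
      also have "\<dots> \<le> index n" unfolding m_def by (rule index_ge)
      finally have "c / index n \<le> c / (m * (real k + 1) ^ 3)"
        using m pos by (intro divide_left_mono mult_pos_pos) auto
      moreover have "ratio n = 1 + c / index n"
        using index_pos[of n] by (simp add: ratio_def add_divide_distrib del: index_pos)
      ultimately have "ratio n \<le> 1 + c / (m * (real k + 1) ^ 3)" by simp
      then show "ratio n \<le> exp (c / (m * (real k + 1) ^ 3))"
        using exp_ge_add_one_self order_trans by blast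
    qed (simp add: less_imp_le)
    also have "\<dots> = exp ((real ((k + 2) ^ 3) - real ((k + 1) ^ 3)) * (c / (m * (real k + 1) ^ 3)))"
    proof -
      have "(k + 1) ^ 3 \<le> (k + 2) ^ 3" by (rule power_mono) auto
      then show ?thesis
        by (simp only: prod_constant card_atLeastLessThan exp_of_nat_mult[symmetric] of_nat_diff)
    qed
    also have "\<dots> \<le> exp (7 * (real k + 1)\<^sup>2 * (c / (m * (real k + 1) ^ 3)))"
      using cube_gap[of k] m pos by (subst exp_le_cancel_iff, intro mult_right_mono) auto
    also have "7 * (real k + 1)\<^sup>2 * (c / (m * (real k + 1) ^ 3)) = 7 * c / m * (1 / (real k + 1))"
    proof -
      have "7 * y\<^sup>2 * (c / (m * y ^ 3)) = 7 * c / m * (1 / y)" if "y > 0" for y :: real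
        using that m by (simp add: field_simps eval_nat_numeral)
      then show ?thesis by simp
    qed
    finally show "(\<Prod>n\<in>{(k + 1) ^ 3..<(k + 2) ^ 3}. ratio n) \<le> exp (7 * c / m * (1 / (real k + 1)))" .
  qed
  have "(\<lambda>k. 1 / (real k + 1)) \<longlonglongrightarrow> 0"
    using LIMSEQ_Suc[OF lim_const_over_n[of 1]] by (simp add: add_ac)
  from tendsto_exp[OF tendsto_mult_right_zero[OF this, of "7 * c / m"]]
  show "(\<lambda>k. exp (7 * c / m * (1 / (real k + 1)))) \<longlonglongrightarrow> 1"
    by simp
qed simp

text \<open>The Beta variables are below 1 and the ratios at least 1, so moving from
  \<open>i\<close> to \<open>j\<close> inside a block multiplies the product by at most all ratios
  of the block. It serves twice: from the lower cube to an index, and from that index to the upper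
  cube.\<close>

lemma partial_ratio_le:
  assumes "\<forall>n. 0 < \<omega> n \<and> \<omega> n < 1" "N \<le> i" "i \<le> j" "j \<le> N'"
  shows "0 < partial j \<omega>" "partial j \<omega> \<le> partial i \<omega> * (\<Prod>n\<in>{N..<N'}. ratio n)"
proof -
  have pp: "0 < partial i \<omega>" for i using assms(1) by (auto simp: partial_def intro!: prod_pos)
  then show "0 < partial j \<omega>" .
  have ratio1: "1 \<le> ratio n" for n
    using pos index_pos[of n] by (simp add: ratio_def del: index_pos)
  have "partial j \<omega> = partial i \<omega> * (\<Prod>n\<in>{i..<j}. ratio n * \<omega> n)"
    unfolding partial_def using assms by (subst prod.union_disjoint[symmetric]) (auto simp: ivl_disj_un_one)
  also have "\<dots> \<le> partial i \<omega> * (\<Prod>n\<in>{N..<N'}. ratio n)"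
  proof (rule mult_left_mono)
    have "(\<Prod>n\<in>{i..<j}. ratio n * \<omega> n) \<le> (\<Prod>n\<in>{i..<j}. ratio n)"
      using assms(1) by (intro prod_mono) (auto intro!: mult_left_le simp: less_imp_le)
    also have "\<dots> \<le> (\<Prod>n\<in>{N..<N'}. ratio n)"
      using assms by (intro prod_mono2 ratio1) (auto simp: less_imp_le)
    finally show "(\<Prod>n\<in>{i..<j}. ratio n * \<omega> n) \<le> (\<Prod>n\<in>{N..<N'}. ratio n)" .
  qed (use pp in \<open>auto simp: less_imp_le\<close>)
  finally show "partial j \<omega> \<le> partial i \<omega> * (\<Prod>n\<in>{N..<N'}. ratio n)" .
qed

lemma AE_partial_tendsto: "AE \<omega> in S. (\<lambda>N. partial N \<omega>) \<longlonglongrightarrow> beta_product a b c \<omega>"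
  using AE_convergent_partial_cubes AE_S
proof eventually_elim
  case (elim \<omega>)
  define R where "R k = (\<Prod>n\<in>{(k + 1) ^ 3..<(k + 2) ^ 3}. ratio n)" for k
  obtain L where L: "(\<lambda>k. partial ((k + 1) ^ 3) \<omega>) \<longlonglongrightarrow> L"
    using elim(1) by (auto simp: convergent_def)
  have R: "R \<longlonglongrightarrow> 1" unfolding R_def by (rule block_ratio_tendsto)
  \<comment> \<open>The number of the block that contains \<open>N\<close>, so that
    \<open>(\<kappa> N + 1) ^ 3 \<le> N < (\<kappa> N + 2) ^ 3\<close>. The lower bound fails at
    \<open>N = 0\<close>, hence the restriction to \<open>1 \<le> N\<close> below.\<close>
  define \<kappa> where "\<kappa> N = (LEAST k. N < (k + 2) ^ 3)" for N :: nat
  have up: "N < (\<kappa> N + 2) ^ 3" for N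
    unfolding \<kappa>_def
  proof (rule LeastI)
    show "N < (N + 2) ^ 3"
      by (rule less_le_trans[OF _ self_le_power]) auto
  qed
  have low: "(\<kappa> N + 1) ^ 3 \<le> N" if "1 \<le> N" for N
  proof (cases "\<kappa> N")
    case (Suc k)
    then have "\<not> N < (k + 2) ^ 3"
      unfolding \<kappa>_def by (metis lessI not_less_Least)
    then show ?thesis by (simp add: Suc)
  qed (use that in simp)
  have \<kappa>: "filterlim \<kappa> at_top sequentially"
    unfolding filterlim_at_top
  proof
    fix Z
    show "\<forall>\<^sub>F N in sequentially. Z \<le> \<kappa> N"
      using eventually_ge_at_top[of "(Z + 2) ^ 3"]
    proof eventually_elim
      case (elim N)
      then have "(Z + 2) ^ 3 < (\<kappa> N + 2) ^ 3" using up[of N] by linarith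
      then have "Z + 2 < \<kappa> N + 2" by (rule power_less_imp_less_base) simp
      then show ?case by simp
    qed
  qed
  have Rp: "R k > 0" for k by (auto simp: R_def intro!: prod_pos)
  have "(\<lambda>N. partial N \<omega>) \<longlonglongrightarrow> L"
  proof (rule tendsto_sandwich)
    show "\<forall>\<^sub>F N in sequentially. partial ((\<kappa> N + 2) ^ 3) \<omega> / R (\<kappa> N) \<le> partial N \<omega>"
      using eventually_ge_at_top[of 1]
    proof eventually_elim
      case N: (elim N)
      have "partial ((\<kappa> N + 2) ^ 3) \<omega> \<le> partial N \<omega> * R (\<kappa> N)"
        unfolding R_def using up[of N] low[OF N] by (intro partial_ratio_le[OF elim(2)]) auto
      then show ?case using Rp[of "\<kappa> N"] by (simp add: divide_le_eq)
    qed
    show "\<forall>\<^sub>F N in sequentially. partial N \<omega> \<le> partial ((\<kappa> N + 1) ^ 3) \<omega> * R (\<kappa> N)"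
      using eventually_ge_at_top[of 1]
    proof eventually_elim
      case N: (elim N)
      show ?case
        unfolding R_def using up[of N] low[OF N] by (intro partial_ratio_le[OF elim(2)]) auto
    qed
    have "(\<lambda>k. partial ((k + 2) ^ 3) \<omega> / R k) \<longlonglongrightarrow> L / 1"
      using LIMSEQ_Suc[OF L] R by (intro tendsto_divide) auto
    from filterlim_compose[OF this \<kappa>]
    show "(\<lambda>N. partial ((\<kappa> N + 2) ^ 3) \<omega> / R (\<kappa> N)) \<longlonglongrightarrow> L" by simp
    have "(\<lambda>k. partial ((k + 1) ^ 3) \<omega> * R k) \<longlonglongrightarrow> L * 1"
      using L R by (intro tendsto_mult) auto
    from filterlim_compose[OF this \<kappa>]
    show "(\<lambda>N. partial ((\<kappa> N + 1) ^ 3) \<omega> * R (\<kappa> N)) \<longlonglongrightarrow> L" by simp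
  qed
  moreover have "beta_product a b c \<omega> = Topological_Spaces.lim (\<lambda>N. partial N \<omega>)"
    by (simp add: beta_product_def partial_def ratio_def)
  ultimately show ?case by (simp add: limI)
qed

lemma borel_measurable_beta_product [measurable]: "beta_product a b c \<in> borel_measurable S"
proof -
  have "beta_product a b c = (\<lambda>\<omega>. Topological_Spaces.lim (\<lambda>N. partial N \<omega>))"
    by (simp add: fun_eq_iff beta_product_def partial_def ratio_def)
  then show ?thesis by simp
qed

end

section \<open>Moments and characteristic functions\<close>

text \<open>The balance condition on the parameters cancels the powers of \<open>n\<close> in the Gamma series.\<close>

lemma tendsto_prod_Gamma:
  fixes x x' y y' :: real
  assumes "x > 0" "x' > 0" "y > 0" "y' > 0" "x + x' = y + y'"
  shows "(\<lambda>N. \<Prod>j<N. (x + real j) * (x' + real j) / ((y + real j) * (y' + real j)))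
    \<longlonglongrightarrow> Gamma y * Gamma y' / (Gamma x * Gamma x')"
proof -
  have rG: "rGamma z \<noteq> 0" if "z > 0" for z :: real
    using that by (auto simp: rGamma_eq_zero_iff elim!: nonpos_Ints_cases)
  have "(\<lambda>n. rGamma_series x n * rGamma_series x' n / (rGamma_series y n * rGamma_series y' n))
      \<longlonglongrightarrow> rGamma x * rGamma x' / (rGamma y * rGamma y')"
    using assms rG by (intro tendsto_intros) auto
  also have "rGamma x * rGamma x' / (rGamma y * rGamma y') = Gamma y * Gamma y' / (Gamma x * Gamma x')"
    by (simp add: rGamma_inverse_Gamma divide_simps)
  also have "(\<lambda>n. rGamma_series x n * rGamma_series x' n / (rGamma_series y n * rGamma_series y' n))
    = (\<lambda>n. \<Prod>j<Suc n. (x + real j) * (x' + real j) / ((y + real j) * (y' + real j)))"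
  proof
    fix n
    define F where "F z = fact n * exp (z * ln (real n))" for z :: real
    have "exp (x * ln (real n)) * exp (x' * ln (real n)) = exp (y * ln (real n)) * exp (y' * ln (real n))"
      using assms(5) by (simp flip: exp_add distrib_right)
    then have "F x * F x' = F y * F y'" and "F z \<noteq> 0" for z
      by (simp_all add: F_def)
    moreover have "rGamma_series z n = pochhammer z (Suc n) / F z" for z
      by (simp add: rGamma_series_def F_def)
    ultimately have "rGamma_series x n * rGamma_series x' n / (rGamma_series y n * rGamma_series y' n)
        = pochhammer x (Suc n) * pochhammer x' (Suc n) / (pochhammer y (Suc n) * pochhammer y' (Suc n))"
      by simp
    also have "\<dots> = (\<Prod>j<Suc n. (x + real j) * (x' + real j) / ((y + real j) * (y' + real j)))"
      unfolding pochhammer_prod atLeast0LessThan by (simp only: prod.distrib prod_dividef)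
    finally show "rGamma_series x n * rGamma_series x' n / (rGamma_series y n * rGamma_series y' n) = \<dots>" .
  qed
  \<comment> \<open>The reciprocal Gamma series at \<open>n\<close> carries the \<open>Suc n\<close>
    factors with \<open>j\<close> from 0 to \<open>n\<close>, so the limit so far concerns the
    shifted products.\<close>
  finally show ?thesis
    by (rule LIMSEQ_imp_Suc)
qed

section \<open>Decay of Gamma quotients and growth of the moments\<close>

lemma Gamma_plus1_pos: "x > 0 \<Longrightarrow> Gamma (x + 1) = x * Gamma x" for x :: real
  by (intro Gamma_plus1) (auto elim!: nonpos_Ints_cases)

text \<open>Log-convexity of Gamma at \<open>y + 1\<close>, the convex combination of
  \<open>y + s\<close> and \<open>y + s + 1\<close> with weights \<open>s\<close> and
  \<open>1 - s\<close>, gives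
  \<open>Gamma (y + 1) \<le> Gamma (y + s) * (y + s) powr (1 - s)\<close>. Since
  \<open>Gamma (y + 1) = y * Gamma y\<close>, the quotient decays like
  \<open>y powr (- s)\<close>.\<close>

lemma Gamma_ratio_tendsto_0:
  fixes s :: real
  assumes "0 < s" "s < 1"
  shows "((\<lambda>y. Gamma y / Gamma (y + s)) \<longlongrightarrow> 0) at_top"
proof (rule tendsto_sandwich)
  show "\<forall>\<^sub>F y in at_top. 0 \<le> Gamma y / Gamma (y + s)"
    using eventually_gt_at_top[of 0]
    by eventually_elim (use assms in \<open>auto simp: Gamma_real_pos less_imp_le\<close>)
  show "\<forall>\<^sub>F y in at_top. Gamma y / Gamma (y + s) \<le> 2 powr (1 - s) * y powr (- s)"
    \<comment> \<open>For \<open>y > s\<close> one has \<open>y + s \<le> 2 * y\<close>, the source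
      of the constant \<open>2 powr (1 - s)\<close>.\<close>
    using eventually_gt_at_top[of s]
  proof eventually_elim
    case *: (elim y)
    then have elim: "y > 0" using assms by simp
    have G: "Gamma (y + s) > 0" "Gamma (y + 1) > 0" "Gamma (y + s + 1) > 0"
      using assms elim by (auto intro!: Gamma_real_pos)
    have "(ln \<circ> Gamma) ((1 - (1 - s)) *\<^sub>R (y + s) + (1 - s) *\<^sub>R (y + s + 1))
        \<le> (1 - (1 - s)) * (ln \<circ> Gamma) (y + s) + (1 - s) * (ln \<circ> Gamma) (y + s + 1)"
      using assms elim by (intro convex_onD[OF log_convex_Gamma_real]) auto
    moreover have "(1 - (1 - s)) *\<^sub>R (y + s) + (1 - s) *\<^sub>R (y + s + 1) = y + 1"
      by (simp add: algebra_simps)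
    moreover have "Gamma (y + s + 1) = (y + s) * Gamma (y + s)"
      using assms elim by (intro Gamma_plus1_pos) auto
    ultimately have "ln (Gamma (y + 1)) \<le> s * ln (Gamma (y + s)) + (1 - s) * ln ((y + s) * Gamma (y + s))"
      by simp
    also have "ln ((y + s) * Gamma (y + s)) = ln (y + s) + ln (Gamma (y + s))"
      using assms elim G by (intro ln_mult_pos) auto
    also have "s * ln (Gamma (y + s)) + (1 - s) * (ln (y + s) + ln (Gamma (y + s))) = ln (Gamma (y + s)) + (1 - s) * ln (y + s)"
      by (simp add: algebra_simps)
    also have "\<dots> = ln (Gamma (y + s) * (y + s) powr (1 - s))"
      using assms elim G by (subst ln_mult_pos) (auto simp: ln_powr)
    finally have "ln (Gamma (y + 1)) \<le> ln (Gamma (y + s) * (y + s) powr (1 - s))" .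
    then have "Gamma (y + 1) \<le> Gamma (y + s) * (y + s) powr (1 - s)"
      using assms elim G by (subst (asm) ln_le_cancel_iff) auto
    moreover have "Gamma (y + 1) = y * Gamma y"
      using elim by (rule Gamma_plus1_pos)
    ultimately have "Gamma y / Gamma (y + s) \<le> (y + s) powr (1 - s) / y"
      using G elim by (simp add: field_simps)
    also have "\<dots> \<le> (2 * y) powr (1 - s) / y"
      using assms * elim by (intro divide_right_mono powr_mono2) auto
    also have "\<dots> = 2 powr (1 - s) * y powr (- s)"
      using elim by (simp add: powr_mult powr_diff powr_minus field_simps)
    finally show ?case .
  qed
  show "((\<lambda>y. 2 powr (1 - s) * y powr (- s)) \<longlongrightarrow> 0) at_top"
    using assms by (intro tendsto_mult_right_zero tendsto_neg_powr filterlim_ident) auto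
qed simp

definition limit_moment :: "real \<Rightarrow> real \<Rightarrow> nat \<Rightarrow> real" where
  "limit_moment \<alpha> b n = fact n * (\<Prod>i<n. Gamma (real (Suc i) * b) / Gamma (real (Suc i) * b + \<alpha>))"

text \<open>Once the factorials cancel, consecutive terms have the quotient
  \<open>\<bar>\<theta>\<bar> * r n\<close>, which tends to 0. The terms are thus even summable for
  every \<theta>, so the Taylor remainder of the characteristic function vanishes on the whole
  line.\<close>

lemma limit_moment_growth:
  fixes \<theta> :: real
  assumes "0 < \<alpha>" "\<alpha> < 1" "0 < b"
  shows "(\<lambda>n. \<bar>\<theta>\<bar> ^ n / fact n * limit_moment \<alpha> b n) \<longlonglongrightarrow> 0"
proof -
  define r where "r i = Gamma (real (Suc i) * b) / Gamma (real (Suc i) * b + \<alpha>)" for i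
  have r0: "0 \<le> r i" for i
    using assms by (auto simp: r_def less_imp_le intro!: divide_nonneg_nonneg Gamma_real_nonneg add_nonneg_pos mult_nonneg_nonneg)
  have "filterlim (\<lambda>i. real (Suc i) * b) at_top sequentially"
    using assms by (intro filterlim_at_top_mult_tendsto_pos[OF tendsto_const]
        filterlim_compose[OF filterlim_real_sequentially filterlim_Suc]) auto
  then have "r \<longlonglongrightarrow> 0"
    unfolding r_def by (rule filterlim_compose[OF Gamma_ratio_tendsto_0[OF assms(1,2)]])
  then have "(\<lambda>i. \<bar>\<theta>\<bar> * r i) \<longlonglongrightarrow> 0"
    by (rule tendsto_mult_right_zero)
  then have "\<forall>\<^sub>F i in sequentially. \<bar>\<theta>\<bar> * r i < 1 / 2"
    by (rule order_tendstoD) simp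
  then obtain N where N: "\<And>i. i \<ge> N \<Longrightarrow> \<bar>\<theta>\<bar> * r i < 1 / 2"
    by (auto simp: eventually_sequentially)
  define s where "s n = (\<Prod>i<n. \<bar>\<theta>\<bar> * r i)" for n
  have s0: "0 \<le> s n" for n
    unfolding s_def by (intro prod_nonneg) (simp add: r0)
  have "summable s"
  proof (rule summable_ratio_test)
    show "norm (s (Suc n)) \<le> 1 / 2 * norm (s n)" if "N \<le> n" for n
    proof -
      have "s (Suc n) = \<bar>\<theta>\<bar> * r n * s n" by (simp add: s_def)
      also have "\<dots> \<le> 1 / 2 * s n"
        using N[OF that] s0[of n] by (intro mult_right_mono) auto
      finally show ?thesis using s0[of n] s0[of "Suc n"] by simp
    qed
  qed simp
  then have "s \<longlonglongrightarrow> 0" by (rule summable_LIMSEQ_zero)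
  moreover have "s = (\<lambda>n. \<bar>\<theta>\<bar> ^ n / fact n * limit_moment \<alpha> b n)"
    by (simp add: fun_eq_iff s_def limit_moment_def r_def prod.distrib prod_dividef)
  ultimately show ?thesis by simp
qed

text \<open>Spelling out the Pochhammer symbols writes each factor moment as a product over
  \<open>i < k\<close>. After the two products are swapped, every \<open>i\<close> contributes one
  Gamma limit, whose parameters are \<open>b\<close> times the Beta parameters and satisfy the
  balance condition.\<close>

lemma tendsto_beta_product_moments:
  fixes \<alpha> q :: real
  assumes "0 < \<alpha>" "\<alpha> < 1" "q > \<alpha>"
  defines "b \<equiv> q - \<alpha>"
  shows "(\<lambda>N. \<Prod>n<N. beta_factors.factor_moment (q / b) (1 / b) ((1 - \<alpha>) / b) n k)
    \<longlonglongrightarrow> (Gamma q / Gamma b) ^ k * limit_moment \<alpha> b k"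
proof -
  have b: "b > 0" using assms by simp
  have q: "q > 0" "q = b + \<alpha>" using assms by (simp_all add: b_def)
  interpret beta_factors "q / b" "1 / b" "(1 - \<alpha>) / b"
    by unfold_locales (use assms(2) b q(1) in auto)
  define f where "f i n = (q + 1 - \<alpha> + real n) * (q + real i * b + real n) / ((q + real n) * (q + real i * b + 1 - \<alpha> + real n))" for i n
  have fm: "factor_moment n k = (\<Prod>i<k. f i n)" for n
  proof -
    have "factor_moment n k = (\<Prod>i<k. ratio n * ((index n + real i) / (index n + (1 - \<alpha>) / b + real i)))"
      by (simp add: factor_moment_def pochhammer_prod atLeast0LessThan prod.distrib prod_dividef)
    also have "\<dots> = (\<Prod>i<k. f i n)"
    proof (rule prod.cong[OF refl])
      fix i
      have "index n = (q + n) / b" "index n + real i = (q + real i * b + real n) / b"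
        "index n + (1 - \<alpha>) / b = (q + 1 - \<alpha> + real n) / b"
        "index n + (1 - \<alpha>) / b + real i = (q + real i * b + 1 - \<alpha> + real n) / b"
        using b by (simp_all add: field_simps)
      then show "ratio n * ((index n + real i) / (index n + (1 - \<alpha>) / b + real i)) = f i n"
        using b by (simp add: ratio_def f_def)
    qed
    finally show ?thesis .
  qed
  have lim: "(\<lambda>N. \<Prod>n<N. f i n) \<longlonglongrightarrow> Gamma q / Gamma b * (real (Suc i) * (Gamma (real (Suc i) * b) / Gamma (real (Suc i) * b + \<alpha>)))" for i
  proof -
    have ib: "real i * b \<ge> 0" using b by simp
    have "(\<lambda>N. \<Prod>n<N. f i n) \<longlonglongrightarrow> Gamma q * Gamma (q + real i * b + 1 - \<alpha>) / (Gamma (q + 1 - \<alpha>) * Gamma (q + real i * b))"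
      unfolding f_def using assms(1-3) q ib by (intro tendsto_prod_Gamma) linarith+
    also have "q + real i * b + 1 - \<alpha> = real (Suc i) * b + 1"
      unfolding q(2) by (simp add: algebra_simps)
    also have "q + 1 - \<alpha> = b + 1"
      unfolding q(2) by simp
    also have "q + real i * b = real (Suc i) * b + \<alpha>"
      unfolding q(2) by (simp add: algebra_simps)
    \<comment> \<open>The functional equation leaves the quotient
      \<open>real (Suc i) * b / b\<close>; over all \<open>i\<close> these integers multiply up to
      the factorial in \<open>limit_moment\<close>.\<close>
    also have "Gamma q * Gamma (real (Suc i) * b + 1) / (Gamma (b + 1) * Gamma (real (Suc i) * b + \<alpha>))
      = Gamma q / Gamma b * (real (Suc i) * (Gamma (real (Suc i) * b) / Gamma (real (Suc i) * b + \<alpha>)))"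
      using b by (subst (1 2) Gamma_plus1_pos) (simp_all del: of_nat_Suc)
    finally show ?thesis .
  qed
  have "(\<lambda>N. \<Prod>i<k. \<Prod>n<N. f i n) \<longlonglongrightarrow>
     (\<Prod>i<k. Gamma q / Gamma b * (real (Suc i) * (Gamma (real (Suc i) * b) / Gamma (real (Suc i) * b + \<alpha>))))"
    by (intro tendsto_prod lim)
  also have "(\<Prod>i<k. Gamma q / Gamma b * (real (Suc i) * (Gamma (real (Suc i) * b) / Gamma (real (Suc i) * b + \<alpha>))))
    = (Gamma q / Gamma b) ^ k * limit_moment \<alpha> b k"
    by (simp add: limit_moment_def prod.distrib prod_dividef fact_prod_Suc atLeast0LessThan power_divide del: of_nat_Suc)
  finally show ?thesis
    unfolding fm by (subst prod.swap)
qed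

text \<open>Bounded convergence gives the characteristic function of the limit, so no uniform
  integrability is needed to pass to the limit in the moment expansion.\<close>

lemma char_sums_moments:
  fixes X :: "nat \<Rightarrow> 'a \<Rightarrow> real" and Y :: "'a \<Rightarrow> real" and m :: "nat \<Rightarrow> real"
  assumes "prob_space M"
    and [measurable]: "\<And>N. X N \<in> borel_measurable M" "Y \<in> borel_measurable M"
    and nonneg: "\<And>N. AE \<omega> in M. 0 \<le> X N \<omega>"
    and conv: "AE \<omega> in M. (\<lambda>N. X N \<omega>) \<longlonglongrightarrow> Y \<omega>"
    and int: "\<And>N k. integrable M (\<lambda>\<omega>. X N \<omega> ^ k)"
    and mom: "\<And>k. (\<lambda>N. \<integral>\<omega>. X N \<omega> ^ k \<partial>M) \<longlonglongrightarrow> m k"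
    and growth: "\<And>\<theta>. (\<lambda>n. \<bar>\<theta>\<bar> ^ n / fact n * m n) \<longlonglongrightarrow> 0"
  shows "(\<lambda>n. \<Sum>k\<le>n. (\<i> * of_real t) ^ k / fact k * of_real (m k)) \<longlonglongrightarrow> char (distr M borel Y) t"
proof -
  interpret prob_space M by fact
  let ?\<phi> = "\<lambda>N. char (distr M borel (X N)) t"
  have \<phi>: "?\<phi> \<longlonglongrightarrow> char (distr M borel Y) t"
  proof -
    have "(\<lambda>N. \<integral>\<omega>. iexp (t * X N \<omega>) \<partial>M) \<longlonglongrightarrow> (\<integral>\<omega>. iexp (t * Y \<omega>) \<partial>M)"
    proof (rule integral_dominated_convergence[where w="\<lambda>_. 1"])
      show "AE \<omega> in M. (\<lambda>N. iexp (t * X N \<omega>)) \<longlonglongrightarrow> iexp (t * Y \<omega>)"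
        using conv by eventually_elim (intro tendsto_intros)
    qed auto
    then show ?thesis
      by (simp add: char_def integral_distr)
  qed
  \<comment> \<open>The remainder estimate with the factor 2 uses the moment of order
    \<open>n\<close>, not \<open>n + 1\<close>. At fixed \<open>n\<close> both of its sides pass to
    the limit in \<open>N\<close>.\<close>
  have bound: "cmod (char (distr M borel Y) t - (\<Sum>k\<le>n. (\<i> * of_real t) ^ k / fact k * of_real (m k)))
      \<le> 2 * \<bar>t\<bar> ^ n / fact n * m n" for n
  proof (rule tendsto_le)
    show "(\<lambda>N. cmod (?\<phi> N - (\<Sum>k\<le>n. (\<i> * of_real t) ^ k / fact k * of_real (\<integral>\<omega>. X N \<omega> ^ k \<partial>M))))
      \<longlonglongrightarrow> cmod (char (distr M borel Y) t - (\<Sum>k\<le>n. (\<i> * of_real t) ^ k / fact k * of_real (m k)))"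
      by (intro tendsto_intros \<phi> mom)
    show "(\<lambda>N. 2 * \<bar>t\<bar> ^ n / fact n * (\<integral>\<omega>. X N \<omega> ^ n \<partial>M)) \<longlonglongrightarrow> 2 * \<bar>t\<bar> ^ n / fact n * m n"
      by (intro tendsto_intros mom)
    show "\<forall>\<^sub>F N in sequentially. cmod (?\<phi> N - (\<Sum>k\<le>n. (\<i> * of_real t) ^ k / fact k * of_real (\<integral>\<omega>. X N \<omega> ^ k \<partial>M)))
      \<le> 2 * \<bar>t\<bar> ^ n / fact n * (\<integral>\<omega>. X N \<omega> ^ n \<partial>M)"
    proof (intro always_eventually allI)
      fix N
      have "(\<integral>\<omega>. \<bar>X N \<omega>\<bar> ^ n \<partial>M) = (\<integral>\<omega>. X N \<omega> ^ n \<partial>M)"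
        using nonneg[of N] by (intro integral_cong_AE) auto
      then show "cmod (?\<phi> N - (\<Sum>k\<le>n. (\<i> * of_real t) ^ k / fact k * of_real (\<integral>\<omega>. X N \<omega> ^ k \<partial>M)))
          \<le> 2 * \<bar>t\<bar> ^ n / fact n * (\<integral>\<omega>. X N \<omega> ^ n \<partial>M)"
        using char_approx1'[of n "X N" "distr M borel (X N)" t] int by simp
    qed
  qed simp
  have "(\<lambda>n. 2 * \<bar>t\<bar> ^ n / fact n * m n) \<longlonglongrightarrow> 0"
    using tendsto_mult_right_zero[OF growth[of t], of 2] by (simp add: mult_ac)
  then have "(\<lambda>n. cmod (char (distr M borel Y) t - (\<Sum>k\<le>n. (\<i> * of_real t) ^ k / fact k * of_real (m k)))) \<longlonglongrightarrow> 0"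
    by (rule Lim_null_comparison[rotated]) (use bound in auto)
  then have "(\<lambda>n. char (distr M borel Y) t - (\<Sum>k\<le>n. (\<i> * of_real t) ^ k / fact k * of_real (m k))) \<longlonglongrightarrow> 0"
    by (simp only: tendsto_norm_zero_iff)
  from tendsto_diff[OF tendsto_const this, of "char (distr M borel Y) t"]
  show ?thesis by simp
qed

section \<open>Moments of the integral functional\<close>

text \<open>The plane is split along the diagonal into two triangles; the strict inequality left in
  one of them becomes non-strict because points are null. This is integration by parts for
  cumulative integrals, valid also for infinite values.\<close>

lemma nn_integral_parts:
  fixes g h :: "real \<Rightarrow> ennreal"
  assumes [measurable]: "g \<in> borel_measurable borel" "h \<in> borel_measurable borel"
  shows "(\<integral>\<^sup>+u. g u \<partial>lborel) * (\<integral>\<^sup>+v. h v \<partial>lborel) =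
    (\<integral>\<^sup>+u. g u * (\<integral>\<^sup>+v. h v * indicator {..u} v \<partial>lborel) \<partial>lborel) +
    (\<integral>\<^sup>+v. h v * (\<integral>\<^sup>+u. g u * indicator {..v} u \<partial>lborel) \<partial>lborel)"
proof -
  have [measurable]: "(\<lambda>u. \<integral>\<^sup>+v. h v * indicator {..u} v \<partial>lborel) \<in> borel_measurable borel"
    "(\<lambda>u. \<integral>\<^sup>+v. h v * indicator {u<..} v \<partial>lborel) \<in> borel_measurable borel"
    unfolding indicator_def atMost_iff greaterThan_iff by measurable
  have "(\<integral>\<^sup>+u. g u \<partial>lborel) * (\<integral>\<^sup>+v. h v \<partial>lborel) = (\<integral>\<^sup>+u. g u * (\<integral>\<^sup>+v. h v \<partial>lborel) \<partial>lborel)"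
    by (simp add: nn_integral_multc)
  also have "\<dots> = (\<integral>\<^sup>+u. g u * ((\<integral>\<^sup>+v. h v * indicator {..u} v \<partial>lborel) + (\<integral>\<^sup>+v. h v * indicator {u<..} v \<partial>lborel)) \<partial>lborel)"
  proof (rule nn_integral_cong, rule arg_cong2[where f="(*)", OF refl])
    fix u
    show "(\<integral>\<^sup>+v. h v \<partial>lborel) = (\<integral>\<^sup>+v. h v * indicator {..u} v \<partial>lborel) + (\<integral>\<^sup>+v. h v * indicator {u<..} v \<partial>lborel)"
      by (subst nn_integral_add[symmetric]) (auto intro!: nn_integral_cong split: split_indicator)
  qed
  also have "\<dots> = (\<integral>\<^sup>+u. g u * (\<integral>\<^sup>+v. h v * indicator {..u} v \<partial>lborel) \<partial>lborel) + (\<integral>\<^sup>+u. g u * (\<integral>\<^sup>+v. h v * indicator {u<..} v \<partial>lborel) \<partial>lborel)"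
    by (simp add: distrib_left nn_integral_add)
  also have "(\<integral>\<^sup>+u. g u * (\<integral>\<^sup>+v. h v * indicator {u<..} v \<partial>lborel) \<partial>lborel) = (\<integral>\<^sup>+u. (\<integral>\<^sup>+v. (if u < v then g u * h v else 0) \<partial>lborel) \<partial>lborel)"
    by (subst nn_integral_cmult[symmetric]) (auto intro!: nn_integral_cong split: split_indicator)
  also have "\<dots> = (\<integral>\<^sup>+v. (\<integral>\<^sup>+u. (if u < v then g u * h v else 0) \<partial>lborel) \<partial>lborel)"
    by (rule lborel_pair.Fubini') measurable
  also have "\<dots> = (\<integral>\<^sup>+v. h v * (\<integral>\<^sup>+u. g u * indicator {..v} u \<partial>lborel) \<partial>lborel)"
  proof (rule nn_integral_cong)
    fix v
    have "(\<integral>\<^sup>+u. (if u < v then g u * h v else 0) \<partial>lborel) = (\<integral>\<^sup>+u. h v * (g u * indicator {..v} u) \<partial>lborel)"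
      using AE_lborel_singleton[of v] by (intro nn_integral_cong_AE) (auto simp: mult_ac split: split_indicator elim!: eventually_mono)
    then show "(\<integral>\<^sup>+u. (if u < v then g u * h v else 0) \<partial>lborel) = h v * (\<integral>\<^sup>+u. g u * indicator {..v} u \<partial>lborel)"
      by (simp add: nn_integral_cmult)
  qed
  finally show ?thesis .
qed

text \<open>Integration by parts against a density of the cumulative integral to the power
  \<open>m + 1\<close> produces one integral \<open>X\<close> and \<open>(m + 1) * X\<close>,
  together \<open>(m + 2) * X\<close>. The function \<open>g\<close> is generalised because the
  induction hypothesis is applied to its truncations too.\<close>

lemma nn_integral_power_Suc:
  fixes g :: "real \<Rightarrow> ennreal"
  assumes "g \<in> borel_measurable borel"
  shows "(\<integral>\<^sup>+u. g u \<partial>lborel) ^ Suc m =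
    of_nat (Suc m) * (\<integral>\<^sup>+u. g u * (\<integral>\<^sup>+v. g v * indicator {..u} v \<partial>lborel) ^ m \<partial>lborel)"
  using assms
proof (induction m arbitrary: g)
  case (Suc m)
  note [measurable] = Suc.prems
  define A where "A u = (\<integral>\<^sup>+v. g v * indicator {..u} v \<partial>lborel)" for u
  have [measurable]: "A \<in> borel_measurable borel"
    unfolding A_def indicator_def atMost_iff by measurable
  let ?h = "\<lambda>u. of_nat (Suc m) * (g u * A u ^ m)"
  \<comment> \<open>The induction hypothesis for \<open>g\<close> cut off at \<open>u\<close>: below
    \<open>u\<close> the cumulative integrals of \<open>g\<close> and of its truncation coincide, so
    \<open>?h\<close> is a density of \<open>A ^ Suc m\<close>.\<close>
  have trunc: "A u ^ Suc m = (\<integral>\<^sup>+v. ?h v * indicator {..u} v \<partial>lborel)" for u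
  proof -
    have "A u ^ Suc m = of_nat (Suc m) * (\<integral>\<^sup>+v. g v * indicator {..u} v * (\<integral>\<^sup>+w. g w * indicator {..u} w * indicator {..v} w \<partial>lborel) ^ m \<partial>lborel)"
      unfolding A_def by (rule Suc.IH) measurable
    also have "\<dots> = of_nat (Suc m) * (\<integral>\<^sup>+v. g v * indicator {..u} v * A v ^ m \<partial>lborel)"
    proof (rule arg_cong2[where f="(*)", OF refl], rule nn_integral_cong)
      fix v
      show "g v * indicator {..u} v * (\<integral>\<^sup>+w. g w * indicator {..u} w * indicator {..v} w \<partial>lborel) ^ m = g v * indicator {..u} v * A v ^ m"
      proof (cases "v \<le> u")
        case True
        then have "indicator {..u} w * indicator {..v} w = (indicator {..v} w :: ennreal)" for w
          by (auto split: split_indicator)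
        then show ?thesis by (simp add: A_def mult.assoc)
      qed simp
    qed
    also have "\<dots> = (\<integral>\<^sup>+v. of_nat (Suc m) * (g v * indicator {..u} v * A v ^ m) \<partial>lborel)"
      by (rule nn_integral_cmult[symmetric]) measurable
    also have "\<dots> = (\<integral>\<^sup>+v. ?h v * indicator {..u} v \<partial>lborel)"
      by (intro nn_integral_cong) (simp add: mult_ac)
    finally show ?thesis .
  qed
  have "(\<integral>\<^sup>+u. g u \<partial>lborel) ^ Suc (Suc m) = (\<integral>\<^sup>+u. g u \<partial>lborel) * (\<integral>\<^sup>+u. g u \<partial>lborel) ^ Suc m"
    by simp
  also have "(\<integral>\<^sup>+u. g u \<partial>lborel) ^ Suc m = (\<integral>\<^sup>+u. ?h u \<partial>lborel)"
    unfolding Suc.IH[OF Suc.prems] A_def[symmetric] by (rule nn_integral_cmult[symmetric]) measurable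
  also have "(\<integral>\<^sup>+u. g u \<partial>lborel) * (\<integral>\<^sup>+u. ?h u \<partial>lborel)
      = (\<integral>\<^sup>+u. g u * A u ^ Suc m \<partial>lborel) + (\<integral>\<^sup>+u. ?h u * A u \<partial>lborel)"
    unfolding trunc unfolding A_def by (rule nn_integral_parts) (simp_all flip: A_def)
  also have "(\<integral>\<^sup>+u. ?h u * A u \<partial>lborel) = (\<integral>\<^sup>+u. of_nat (Suc m) * (g u * A u ^ Suc m) \<partial>lborel)"
    by (intro nn_integral_cong) (simp add: mult_ac)
  also have "\<dots> = of_nat (Suc m) * (\<integral>\<^sup>+u. g u * A u ^ Suc m \<partial>lborel)"
    by (rule nn_integral_cmult) measurable
  finally show ?case
    by (simp add: A_def distrib_right)
qed simp

lemma nn_integral_power_Suc_atMost: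
  fixes g :: "real \<Rightarrow> ennreal"
  assumes [measurable]: "g \<in> borel_measurable borel"
  shows "(\<integral>\<^sup>+u. g u * indicator {..s} u \<partial>lborel) ^ Suc m =
    of_nat (Suc m) * (\<integral>\<^sup>+u. g u * indicator {..s} u * (\<integral>\<^sup>+v. g v * indicator {..u} v \<partial>lborel) ^ m \<partial>lborel)"
proof -
  have "(\<integral>\<^sup>+u. g u * indicator {..s} u \<partial>lborel) ^ Suc m = of_nat (Suc m) * (\<integral>\<^sup>+v. g v * indicator {..s} v * (\<integral>\<^sup>+w. g w * indicator {..s} w * indicator {..v} w \<partial>lborel) ^ m \<partial>lborel)"
    by (rule nn_integral_power_Suc) measurable
  also have "\<dots> = of_nat (Suc m) * (\<integral>\<^sup>+v. g v * indicator {..s} v * (\<integral>\<^sup>+w. g w * indicator {..v} w \<partial>lborel) ^ m \<partial>lborel)"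
  proof (rule arg_cong2[where f="(*)", OF refl], rule nn_integral_cong)
    fix v
    show "g v * indicator {..s} v * (\<integral>\<^sup>+w. g w * indicator {..s} w * indicator {..v} w \<partial>lborel) ^ m
        = g v * indicator {..s} v * (\<integral>\<^sup>+w. g w * indicator {..v} w \<partial>lborel) ^ m"
    proof (cases "v \<le> s")
      case True
      then have "indicator {..s} w * indicator {..v} w = (indicator {..v} w :: ennreal)" for w
        by (auto split: split_indicator)
      then show ?thesis by (simp add: mult.assoc)
    qed simp
  qed
  finally show ?thesis .
qed

text \<open>Euler's integral after the substitution \<open>l = t / x\<close>. Read from right to
  left it writes a negative power as a mixture of exponentials, to which Laplace transforms
  apply.\<close>

lemma nn_integral_Gamma_kernel:
  fixes p x :: real
  assumes "p > 0" "x > 0"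
  shows "(\<integral>\<^sup>+l. indicator {0..} l * ennreal (l powr (p - 1) * exp (- l * x)) \<partial>lborel) = ennreal (Gamma p * x powr (- p))"
proof -
  have "(\<integral>\<^sup>+l. indicator {0..} l * ennreal (l powr (p - 1) * exp (- l * x)) \<partial>lborel)
      = ennreal (1 / x) * (\<integral>\<^sup>+t. indicator {0..} (0 + 1 / x * t) * ennreal ((0 + 1 / x * t) powr (p - 1) * exp (- (0 + 1 / x * t) * x)) \<partial>lborel)"
    using assms by (subst nn_integral_real_affine[where c="1 / x" and t=0]) auto
  also have "\<dots> = (\<integral>\<^sup>+t. ennreal (1 / x) * (indicator {0..} (0 + 1 / x * t) * ennreal ((0 + 1 / x * t) powr (p - 1) * exp (- (0 + 1 / x * t) * x))) \<partial>lborel)"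
    by (rule nn_integral_cmult[symmetric]) measurable
  also have "\<dots> = (\<integral>\<^sup>+t. ennreal (x powr (- p)) * ennreal (indicator {0..} t * t powr (p - 1) / exp t) \<partial>lborel)"
  proof (rule nn_integral_cong)
    fix t
    show "ennreal (1 / x) * (indicator {0..} (0 + 1 / x * t) * ennreal ((0 + 1 / x * t) powr (p - 1) * exp (- (0 + 1 / x * t) * x)))
       = ennreal (x powr (- p)) * ennreal (indicator {0..} t * t powr (p - 1) / exp t)"
    proof (cases "t \<ge> 0")
      case True
      have "x powr p = x powr (p - 1) * x" using assms by (simp add: powr_diff)
      then have "1 / x * ((t / x) powr (p - 1) * exp (- t)) = x powr (- p) * (t powr (p - 1) / exp t)"
        using True assms by (simp add: powr_divide powr_minus exp_minus field_simps)
      then show ?thesis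
        using True assms by (simp flip: ennreal_mult)
    qed (use assms in \<open>auto simp: zero_le_divide_iff\<close>)
  qed
  also have "\<dots> = ennreal (x powr (- p)) * ennreal (Gamma p)"
    using assms by (subst nn_integral_cmult) (simp_all flip: Gamma_conv_nn_integral_real)
  finally show ?thesis
    using assms by (simp add: mult.commute Gamma_real_pos less_imp_le flip: ennreal_mult)
qed

lemma nn_integral_exp_shifted:
  fixes k u :: real
  assumes "k > 0"
  shows "(\<integral>\<^sup>+s. indicator {u..} s * ennreal (exp (- (s - u) * k)) \<partial>lborel) = ennreal (1 / k)"
proof -
  have "(\<integral>\<^sup>+s. indicator {u..} s * ennreal (exp (- (s - u) * k)) \<partial>lborel)
      = (\<integral>\<^sup>+s. ennreal (exp (- (s - u) * k)) * indicator {u..} s \<partial>lborel)"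
    by (simp add: mult.commute)
  also have "\<dots> = ennreal (0 - (- exp (- (u - u) * k) / k))"
  proof (rule nn_integral_FTC_atLeast[where F="\<lambda>s. - exp (- (s - u) * k) / k"])
    show "((\<lambda>s. - exp (- (s - u) * k) / k) \<longlongrightarrow> 0) at_top"
    proof -
      have "filterlim (\<lambda>s. k * (- u + s)) at_top at_top"
        using assms by (intro filterlim_tendsto_pos_mult_at_top[OF tendsto_const]
          filterlim_tendsto_add_at_top[OF tendsto_const] filterlim_ident) auto
      then have "((\<lambda>s. exp (- (k * (- u + s)))) \<longlongrightarrow> 0) at_top"
        by (intro filterlim_compose[OF exp_at_bot]) (simp add: filterlim_uminus_at_top)
      from tendsto_mult_right_zero[OF this, of "- 1 / k"] show ?thesis
        by (simp add: algebra_simps)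
    qed
  qed (use assms in \<open>auto intro!: derivative_eq_intros\<close>)
  finally show ?thesis using assms by simp
qed

text \<open>Independence says that the joint law is the product of the marginal laws, and null sets
  affect neither. It carries independent increments over to a version that agrees with the given
  process only almost surely.\<close>

lemma (in prob_space) indep_vars_cong_AE:
  assumes ind: "indep_vars M' X I" and fin: "finite I"
    and Y: "\<And>i. i \<in> I \<Longrightarrow> random_variable (M' i) (Y i)"
    and eq: "\<And>i. i \<in> I \<Longrightarrow> AE \<omega> in M. X i \<omega> = Y i \<omega>"
  shows "indep_vars M' Y I"
proof (cases "I = {}")
  case False
  have X: "\<And>i. i \<in> I \<Longrightarrow> random_variable (M' i) (X i)"
    using ind by (auto simp: indep_vars_def)
  have "AE \<omega> in M. \<forall>i\<in>I. X i \<omega> = Y i \<omega>"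
    using fin eq by (intro AE_finite_allI) auto
  then have "AE \<omega> in M. (\<lambda>i\<in>I. X i \<omega>) = (\<lambda>i\<in>I. Y i \<omega>)"
    by eventually_elim (auto simp: restrict_def fun_eq_iff)
  then have "distr M (\<Pi>\<^sub>M i\<in>I. M' i) (\<lambda>\<omega>. \<lambda>i\<in>I. X i \<omega>) = distr M (\<Pi>\<^sub>M i\<in>I. M' i) (\<lambda>\<omega>. \<lambda>i\<in>I. Y i \<omega>)"
    using X Y by (intro distr_cong_AE) (auto intro!: measurable_restrict)
  moreover have "(\<Pi>\<^sub>M i\<in>I. distr M (M' i) (X i)) = (\<Pi>\<^sub>M i\<in>I. distr M (M' i) (Y i))"
    using X Y eq by (intro PiM_cong distr_cong_AE) auto
  ultimately show ?thesis
    using ind X Y False by (simp add: indep_vars_iff_distr_eq_PiM')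
qed (simp add: indep_vars_def indep_sets_def)

lemma (in prob_space) indep_var_nn_integral:
  fixes X Y :: "'a \<Rightarrow> ennreal"
  assumes "indep_var borel X borel Y"
  shows "(\<integral>\<^sup>+\<omega>. X \<omega> * Y \<omega> \<partial>M) = (\<integral>\<^sup>+\<omega>. X \<omega> \<partial>M) * (\<integral>\<^sup>+\<omega>. Y \<omega> \<partial>M)"
proof -
  have "indep_vars (\<lambda>_. borel) (case_bool X Y) UNIV"
    using assms unfolding indep_var_def by (rule indep_vars_cong[THEN iffD1, rotated 3]) (auto split: bool.split)
  from indep_vars_nn_integral[OF _ this] show ?thesis
    by (simp add: UNIV_bool mult.commute)
qed

text \<open>A version with regular paths everywhere, extended by \<open>0\<close> to negative times; right-continuity
  then makes it jointly measurable, which Tonelli's theorem needs.\<close>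

locale regular_stable_subordinator = prob_space +
  fixes \<alpha> :: real and S :: "real \<Rightarrow> 'a \<Rightarrow> real"
  assumes \<alpha>: "0 < \<alpha>" "\<alpha> < 1"
    and measurable_S_fixed: "\<And>t. S t \<in> borel_measurable M"
    and S_nonpos: "\<And>t \<omega>. t \<le> 0 \<Longrightarrow> S t \<omega> = 0"
    and mono_S: "\<And>\<omega>. mono (\<lambda>t. S t \<omega>)"
    and continuous_S: "\<And>t \<omega>. continuous (at_right t) (\<lambda>s. S s \<omega>)"
    and indep_increments: "\<And>(n::nat) t. 0 \<le> t 0 \<Longrightarrow> (\<And>i. i < n \<Longrightarrow> t i \<le> t (Suc i)) \<Longrightarrow>
        indep_vars (\<lambda>_. borel) (\<lambda>i \<omega>. S (t (Suc i)) \<omega> - S (t i) \<omega>) {..<n}"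
    and laplace: "\<And>u s l. 0 \<le> u \<Longrightarrow> u \<le> s \<Longrightarrow> 0 \<le> l \<Longrightarrow>
        (\<integral>\<^sup>+\<omega>. ennreal (exp (- l * (S s \<omega> - S u \<omega>))) \<partial>M) = ennreal (exp (- (s - u) * l powr \<alpha>))"
begin

section \<open>Joint measurability and integrals along the regular path\<close>

lemma S_nonneg: "0 \<le> S t \<omega>"
proof -
  have "S (min t 0) \<omega> \<le> S t \<omega>"
    by (rule monoD[OF mono_S]) simp
  then show ?thesis by (simp add: S_nonpos)
qed

text \<open>The grid point lies strictly to the right of \<open>t\<close> at distance at most
  \<open>u / (n + 1)\<close>, so right-continuity suffices. The choice \<open>u = 1\<close> serves
  joint measurability; taking the time horizon for \<open>u\<close> makes the horizon itself a grid
  point.\<close>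

lemma grid_tendsto:
  fixes t u :: real
  assumes "u > 0"
  shows "(\<lambda>n. S (real_of_int (\<lfloor>t * real (Suc n) / u\<rfloor> + 1) * u / real (Suc n)) \<omega>) \<longlonglongrightarrow> S t \<omega>"
proof -
  define \<kappa> where "\<kappa> n = real_of_int (\<lfloor>t * real (Suc n) / u\<rfloor> + 1) * u / real (Suc n)" for n
  have up: "t < \<kappa> n" for n
  proof -
    have "t * real (Suc n) / u < real_of_int (\<lfloor>t * real (Suc n) / u\<rfloor> + 1)" by linarith
    then have "t * real (Suc n) < real_of_int (\<lfloor>t * real (Suc n) / u\<rfloor> + 1) * u"
      using assms by (subst (asm) pos_divide_less_eq) auto
    then show ?thesis
      unfolding \<kappa>_def by (subst pos_less_divide_eq) auto
  qed
  have low: "\<kappa> n \<le> t + u / real (Suc n)" for n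
  proof -
    have "real_of_int (\<lfloor>t * real (Suc n) / u\<rfloor> + 1) \<le> t * real (Suc n) / u + 1" by linarith
    then have "\<kappa> n \<le> (t * real (Suc n) / u + 1) * u / real (Suc n)"
      unfolding \<kappa>_def using assms by (intro divide_right_mono mult_right_mono) auto
    also have "\<dots> = t + u / real (Suc n)"
    proof -
      have "(t * N / u + 1) * u / N = t + u / N" if "N > 0" for N :: real
        using that assms by (simp add: field_simps)
      then show ?thesis by simp
    qed
    finally show ?thesis .
  qed
  have "\<kappa> \<longlonglongrightarrow> t"
  proof (rule tendsto_sandwich)
    show "\<forall>\<^sub>F n in sequentially. t \<le> \<kappa> n" using up by (intro always_eventually allI less_imp_le)
    show "\<forall>\<^sub>F n in sequentially. \<kappa> n \<le> t + u / real (Suc n)" using low by auto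
    have "(\<lambda>n. t + u / real (Suc n)) \<longlonglongrightarrow> t + 0"
      by (intro tendsto_add tendsto_const LIMSEQ_Suc[OF lim_const_over_n])
    then show "(\<lambda>n. t + u / real (Suc n)) \<longlonglongrightarrow> t" by simp
  qed simp
  then have "filterlim \<kappa> (at_right t) sequentially"
    using up by (auto simp: filterlim_at intro!: always_eventually)
  moreover have "((\<lambda>s. S s \<omega>) \<longlongrightarrow> S t \<omega>) (at_right t)"
    using continuous_S[of t \<omega>] by (simp add: continuous_within)
  ultimately show ?thesis
    unfolding \<kappa>_def[symmetric] by (rule filterlim_compose[rotated])
qed

text \<open>Each approximation evaluates the process at countably many times only, and it is
  measurable at each of them.\<close>

lemma measurable_S_joint: "(\<lambda>x. S (fst x) (snd x)) \<in> borel_measurable (borel \<Otimes>\<^sub>M M)"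
proof (rule borel_measurable_LIMSEQ_real)
  fix x show "(\<lambda>n. S (real_of_int (\<lfloor>fst x * real (Suc n) / 1\<rfloor> + 1) * 1 / real (Suc n)) (snd x)) \<longlonglongrightarrow> S (fst x) (snd x)"
    by (rule grid_tendsto) simp
next
  fix n
  have "(\<lambda>x. S (real_of_int (i + 1) * 1 / real (Suc n)) (snd x)) \<in> borel_measurable (borel \<Otimes>\<^sub>M M)" for i :: int
    by (rule measurable_compose[OF measurable_snd measurable_S_fixed])
  moreover have "(\<lambda>x::real \<times> 'a. \<lfloor>fst x * real (Suc n) / 1\<rfloor>) \<in> borel \<Otimes>\<^sub>M M \<rightarrow>\<^sub>M count_space UNIV"
    by measurable
  ultimately show "(\<lambda>x. S (real_of_int (\<lfloor>fst x * real (Suc n) / 1\<rfloor> + 1) * 1 / real (Suc n)) (snd x)) \<in> borel_measurable (borel \<Otimes>\<^sub>M M)"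
    by (rule measurable_compose_countable)
qed

lemma measurable_S [measurable (raw)]:
  assumes "f \<in> borel_measurable N" "g \<in> N \<rightarrow>\<^sub>M M"
  shows "(\<lambda>x. S (f x) (g x)) \<in> borel_measurable N"
  using measurable_compose[OF measurable_Pair[OF assms] measurable_S_joint] by simp

definition pow :: "real \<Rightarrow> real \<Rightarrow> ennreal" where "pow p x = ennreal ((1 + x) powr (- p))"

lemma measurable_pow [measurable]: "pow p \<in> borel_measurable borel"
  unfolding pow_def by measurable

text \<open>The restriction to nonnegative times belongs to the integrand, which gives the
  cumulative form \<open>g v * indicator {..u} v\<close> of the power formula.\<close>

definition A :: "real \<Rightarrow> real \<Rightarrow> 'a \<Rightarrow> ennreal" where
  "A q u \<omega> = (\<integral>\<^sup>+v. indicator {0..} v * pow q (S v \<omega>) * indicator {..u} v \<partial>lborel)"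

lemma measurable_A [measurable (raw)]:
  assumes [measurable]: "f \<in> borel_measurable N" "g \<in> N \<rightarrow>\<^sub>M M"
  shows "(\<lambda>x. A q (f x) (g x)) \<in> borel_measurable N"
  unfolding A_def indicator_def atMost_iff by measurable

lemma pow_le_1: "0 \<le> x \<Longrightarrow> 0 \<le> p \<Longrightarrow> pow p x \<le> 1"
  using powr_mono[of "- p" 0 "1 + x"] by (simp add: pow_def)

text \<open>The half-open interval prepares the sampling: for \<open>v < u\<close> the next grid
  point is still at most \<open>u\<close>, so the samples involve no path value after
  \<open>u\<close>.\<close>

lemma A_eq: "A q u \<omega> = (\<integral>\<^sup>+v. indicator {0..<u} v * pow q (S v \<omega>) \<partial>lborel)"
  unfolding A_def using AE_lborel_singleton[of u]
  by (intro nn_integral_cong_AE) (auto split: split_indicator elim!: eventually_mono)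

lemma A_le:
  assumes "0 \<le> q" "0 \<le> u"
  shows "A q u \<omega> \<le> ennreal u"
proof -
  have "A q u \<omega> \<le> (\<integral>\<^sup>+v. indicator {0..<u} v \<partial>lborel)"
    unfolding A_eq using assms by (intro nn_integral_mono) (auto simp: pow_le_1 S_nonneg split: split_indicator)
  then show ?thesis using assms by simp
qed

text \<open>Sampling the path at the next grid point gives a function of finitely many increments before
  time \<open>u\<close>, hence independent of the increments after \<open>u\<close>.\<close>

definition grid_A :: "real \<Rightarrow> nat \<Rightarrow> real \<Rightarrow> 'a \<Rightarrow> ennreal" where
  "grid_A q n u \<omega> = (\<integral>\<^sup>+v. indicator {0..<u} v *
     pow q (S (real_of_int (\<lfloor>v * real (Suc n) / u\<rfloor> + 1) * u / real (Suc n)) \<omega>) \<partial>lborel)"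

lemma measurable_grid_A [measurable]: "grid_A q n u \<in> borel_measurable M"
  unfolding grid_A_def by measurable

lemma grid_A_le:
  assumes "0 \<le> q" "0 \<le> u"
  shows "grid_A q n u \<omega> \<le> ennreal u"
proof -
  have "grid_A q n u \<omega> \<le> (\<integral>\<^sup>+v. indicator {0..<u} v \<partial>lborel)"
    unfolding grid_A_def using assms by (intro nn_integral_mono) (auto simp: pow_le_1 S_nonneg split: split_indicator)
  then show ?thesis using assms by simp
qed

lemma grid_A_tendsto:
  assumes "0 \<le> q" "0 < u" "\<omega> \<in> space M"
  shows "(\<lambda>n. grid_A q n u \<omega>) \<longlonglongrightarrow> A q u \<omega>"
  unfolding grid_A_def A_eq
proof (rule nn_integral_dominated_convergence[where w="indicator {0..<u}"])
  note [measurable] = assms(3)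
  show "(\<lambda>v. indicator {0..<u} v * pow q (S (real_of_int (\<lfloor>v * real (Suc n) / u\<rfloor> + 1) * u / real (Suc n)) \<omega>)) \<in> borel_measurable lborel" for n
    by measurable
  show "(\<lambda>v. indicator {0..<u} v * pow q (S v \<omega>)) \<in> borel_measurable lborel"
    by measurable
  show "AE v in lborel. (\<lambda>n. indicator {0..<u} v * pow q (S (real_of_int (\<lfloor>v * real (Suc n) / u\<rfloor> + 1) * u / real (Suc n)) \<omega>)) \<longlonglongrightarrow> indicator {0..<u} v * pow q (S v \<omega>)"
  proof (rule AE_I2)
    fix v
    have "1 + S v \<omega> \<noteq> 0" using S_nonneg[of v \<omega>] by simp
    then have "(\<lambda>n. pow q (S (real_of_int (\<lfloor>v * real (Suc n) / u\<rfloor> + 1) * u / real (Suc n)) \<omega>)) \<longlonglongrightarrow> pow q (S v \<omega>)"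
      unfolding pow_def using assms(2) by (intro tendsto_ennrealI tendsto_powr tendsto_intros grid_tendsto) auto
    then show "(\<lambda>n. indicator {0..<u} v * pow q (S (real_of_int (\<lfloor>v * real (Suc n) / u\<rfloor> + 1) * u / real (Suc n)) \<omega>)) \<longlonglongrightarrow> indicator {0..<u} v * pow q (S v \<omega>)"
      by (auto split: split_indicator)
  qed
qed (use assms in \<open>auto simp: pow_le_1 S_nonneg split: split_indicator\<close>)

end

lemma tendsto_power_ennreal:
  fixes a :: ennreal
  assumes "(f \<longlongrightarrow> a) F" "a < \<top>"
  shows "((\<lambda>x. f x ^ m) \<longlongrightarrow> a ^ m) F"
proof (induction m)
  case (Suc m)
  then show ?case
    using assms by (auto intro!: tendsto_mult_ennreal simp: less_top[symmetric] power_eq_top_ennreal)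
qed simp

section \<open>Independence of the path integral from later increments\<close>

context regular_stable_subordinator begin

text \<open>Divide \<open>{0..u}\<close> into \<open>n + 1\<close> equal pieces and append one step
  from \<open>u\<close> to \<open>s\<close>. Then \<open>grid_A\<close> and \<open>S u\<close> are
  functions of the first \<open>n + 1\<close> increments and the exponential is a function of the
  last one, so the expectation splits.\<close>

lemma grid_factorisation:
  assumes "0 \<le> q" "0 < u" "u \<le> s" "0 \<le> l"
    and [measurable]: "h \<in> borel_measurable borel"
  shows "(\<integral>\<^sup>+\<omega>. grid_A q n u \<omega> ^ m * h (S u \<omega>) * ennreal (exp (- l * (S s \<omega> - S u \<omega>))) \<partial>M)
    = (\<integral>\<^sup>+\<omega>. grid_A q n u \<omega> ^ m * h (S u \<omega>) \<partial>M) * ennreal (exp (- (s - u) * l powr \<alpha>))"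
proof -
  define t where "t i = (if i \<le> Suc n then real i * u / real (Suc n) else s)" for i
  define D where "D i \<omega> = S (t (Suc i)) \<omega> - S (t i) \<omega>" for i \<omega>
  have t0: "t 0 = 0" and tu: "t (Suc n) = u" and ts: "t (Suc (Suc n)) = s"
    by (simp_all add: t_def)
  have "t i \<le> t (Suc i)" if "i < Suc (Suc n)" for i
  proof (cases "i < Suc n")
    case True
    then show ?thesis using assms(2) by (simp add: t_def divide_right_mono mult_right_mono)
  next
    case False
    then have "i = Suc n" using that by simp
    then show ?thesis using assms(3) tu ts by simp
  qed
  then have ind: "indep_vars (\<lambda>_. borel) D {..<Suc (Suc n)}"
    unfolding D_def by (intro indep_increments) (auto simp: t0)
  \<comment> \<open>As a function of the increments, the path at the next grid point is the sum of
    those with index at most the rounded-down position of \<open>v\<close>. A sum of fixed length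
    with vanishing terms keeps \<open>F\<close> visibly measurable.\<close>
  define F where "F d = (\<integral>\<^sup>+v. indicator {0..<u} v *
     pow q (\<Sum>i<Suc n. if int i \<le> \<lfloor>v * real (Suc n) / u\<rfloor> then d i else 0) \<partial>lborel) ^ m * h (\<Sum>i<Suc n. d i)"
    for d :: "nat \<Rightarrow> real"
  define G where "G d = ennreal (exp (- l * d (Suc n)))" for d :: "nat \<Rightarrow> real"
  have tele: "(\<Sum>i<k. D i \<omega>) = S (t k) \<omega>" for k \<omega>
    using sum_lessThan_telescope[of "\<lambda>i. S (t i) \<omega>" k] by (simp add: D_def t0 S_nonpos)
  have F: "F (restrict (\<lambda>i. D i \<omega>) {..<Suc n}) = grid_A q n u \<omega> ^ m * h (S u \<omega>)" for \<omega>
  proof -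
    have "(\<Sum>i<Suc n. restrict (\<lambda>i. D i \<omega>) {..<Suc n} i) = S u \<omega>"
      using tele[of \<omega> "Suc n"] by (simp add: tu del: sum.lessThan_Suc)
    moreover have "indicator {0..<u} v * pow q (\<Sum>i<Suc n. if int i \<le> \<lfloor>v * real (Suc n) / u\<rfloor> then restrict (\<lambda>i. D i \<omega>) {..<Suc n} i else 0)
      = indicator {0..<u} v * pow q (S (real_of_int (\<lfloor>v * real (Suc n) / u\<rfloor> + 1) * u / real (Suc n)) \<omega>)" for v
    proof (cases "v \<in> {0..<u}")
      case True
      define k where "k = nat \<lfloor>v * real (Suc n) / u\<rfloor>"
      have "0 \<le> v * real (Suc n) / u" using True assms(2) by simp
      then have k: "\<lfloor>v * real (Suc n) / u\<rfloor> = int k" by (simp add: k_def)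
      have "v * real (Suc n) / u < real (Suc n)"
        using True assms(2) by (simp add: divide_less_eq mult.commute del: of_nat_Suc)
      then have "k < Suc n"
        using k by linarith
      have "(\<Sum>i<Suc n. if int i \<le> \<lfloor>v * real (Suc n) / u\<rfloor> then restrict (\<lambda>i. D i \<omega>) {..<Suc n} i else 0) = (\<Sum>i<Suc n. if i \<le> k then D i \<omega> else 0)"
        unfolding k by (intro sum.cong) auto
      also have "\<dots> = (\<Sum>i<Suc k. D i \<omega>)"
        using \<open>k < Suc n\<close> by (intro sum.mono_neutral_cong_right) auto
      also have "\<dots> = S (t (Suc k)) \<omega>" by (rule tele)
      also have "t (Suc k) = real_of_int (\<lfloor>v * real (Suc n) / u\<rfloor> + 1) * u / real (Suc n)"
        unfolding k using \<open>k < Suc n\<close> by (simp add: t_def add_ac)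
      finally show ?thesis by simp
    qed simp
    ultimately show ?thesis
      unfolding F_def grid_A_def by simp
  qed
  have G: "G (restrict (\<lambda>i. D i \<omega>) {Suc n}) = ennreal (exp (- l * (S s \<omega> - S u \<omega>)))" for \<omega>
    by (simp add: G_def D_def tu ts)
  have Fm: "F \<in> borel_measurable (\<Pi>\<^sub>M i\<in>{..<Suc n}. borel)"
    unfolding F_def by measurable
  have Gm: "G \<in> borel_measurable (\<Pi>\<^sub>M i\<in>{Suc n}. borel)"
    unfolding G_def by measurable
  have "indep_var (\<Pi>\<^sub>M i\<in>{..<Suc n}. borel) (\<lambda>\<omega>. restrict (\<lambda>i. D i \<omega>) {..<Suc n})
      (\<Pi>\<^sub>M i\<in>{Suc n}. borel) (\<lambda>\<omega>. restrict (\<lambda>i. D i \<omega>) {Suc n})"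
    by (rule indep_var_restrict[OF ind]) auto
  from indep_var_compose[OF this Fm Gm]
  have "indep_var borel (\<lambda>\<omega>. grid_A q n u \<omega> ^ m * h (S u \<omega>)) borel (\<lambda>\<omega>. ennreal (exp (- l * (S s \<omega> - S u \<omega>))))"
    unfolding comp_def F G .
  from indep_var_nn_integral[OF this] show ?thesis
    using assms by (simp only: laplace)
qed

lemma A_zero: "u \<le> 0 \<Longrightarrow> A q u \<omega> = 0"
  by (simp add: A_eq)

text \<open>The grid version passes to the limit by dominated convergence with bound
  \<open>u^m\<close>: the sampled integral is at most \<open>u\<close>, while \<open>h\<close> and
  the exponential of the nonnegative increment are at most 1.\<close>

lemma factorisation:
  assumes "0 \<le> q" "0 \<le> u" "u \<le> s" "0 \<le> l"
    and [measurable]: "h \<in> borel_measurable borel" and h: "\<And>x. 0 \<le> x \<Longrightarrow> h x \<le> 1"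
  shows "(\<integral>\<^sup>+\<omega>. A q u \<omega> ^ m * h (S u \<omega>) * ennreal (exp (- l * (S s \<omega> - S u \<omega>))) \<partial>M)
    = (\<integral>\<^sup>+\<omega>. A q u \<omega> ^ m * h (S u \<omega>) \<partial>M) * ennreal (exp (- (s - u) * l powr \<alpha>))"
\<comment> \<open>The grid spacing is a fraction of \<open>u\<close>, so time 0 is treated apart;
  there the past is deterministic.\<close>
proof (cases "u = 0")
  case True
  have "(\<integral>\<^sup>+\<omega>. A q u \<omega> ^ m * h (S u \<omega>) * ennreal (exp (- l * (S s \<omega> - S u \<omega>))) \<partial>M)
      = (\<integral>\<^sup>+\<omega>. 0 ^ m * h 0 * ennreal (exp (- l * (S s \<omega> - S u \<omega>))) \<partial>M)"
    by (simp add: A_zero True S_nonpos)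
  also have "\<dots> = 0 ^ m * h 0 * ennreal (exp (- (s - u) * l powr \<alpha>))"
    using assms laplace[of u s l] by (subst nn_integral_cmult) simp_all
  finally show ?thesis
    by (simp add: A_zero True S_nonpos emeasure_space_1)
next
  case False
  then have u: "0 < u" using assms by simp
  have Afin: "A q u \<omega> < \<top>" for \<omega>
    using A_le[OF assms(1,2), of \<omega>] by (rule le_less_trans) simp
  have le: "ennreal (exp (- l * (S s \<omega> - S u \<omega>))) \<le> 1" for \<omega>
    using assms monoD[OF mono_S assms(3), of \<omega>] by (simp add: mult_nonneg_nonneg)
  have hS: "h (S u \<omega>) \<le> 1" for \<omega>
    by (intro h S_nonneg)
  have fin: "(\<integral>\<^sup>+\<omega>. ennreal u ^ m \<partial>M) < \<infinity>"
    by (simp add: emeasure_space_1 ennreal_power[OF assms(2)])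
  have hfin: "h (S u \<omega>) \<noteq> \<top>" "ennreal (exp (- l * (S s \<omega> - S u \<omega>))) \<noteq> \<top>" for \<omega>
    using hS[of \<omega>] by (auto simp: top_unique)
  have Apfin: "A q u \<omega> ^ m \<noteq> \<top>" for \<omega>
    using Afin[of \<omega>] by (simp add: power_eq_top_ennreal less_top)
  have lim: "(\<lambda>n. grid_A q n u \<omega> ^ m * h (S u \<omega>)) \<longlonglongrightarrow> A q u \<omega> ^ m * h (S u \<omega>)" if "\<omega> \<in> space M" for \<omega>
    using Afin[of \<omega>] hfin[of \<omega>] Apfin[of \<omega>] grid_A_tendsto[OF assms(1) u that]
    by (intro tendsto_mult_ennreal tendsto_power_ennreal tendsto_const) auto
  have b1: "grid_A q n u \<omega> ^ m * h (S u \<omega>) \<le> ennreal u ^ m" for n \<omega>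
    using mult_mono[OF power_mono[OF grid_A_le[OF assms(1,2), of n \<omega>]] hS, of m \<omega>] by simp
  have 1: "(\<lambda>n. \<integral>\<^sup>+\<omega>. grid_A q n u \<omega> ^ m * h (S u \<omega>) \<partial>M) \<longlonglongrightarrow> (\<integral>\<^sup>+\<omega>. A q u \<omega> ^ m * h (S u \<omega>) \<partial>M)"
    by (rule nn_integral_dominated_convergence[where w="\<lambda>_. ennreal u ^ m"])
       (use lim fin b1 in \<open>auto intro!: AE_I2\<close>)
  have 2: "(\<lambda>n. \<integral>\<^sup>+\<omega>. grid_A q n u \<omega> ^ m * h (S u \<omega>) * ennreal (exp (- l * (S s \<omega> - S u \<omega>))) \<partial>M) \<longlonglongrightarrow>
      (\<integral>\<^sup>+\<omega>. A q u \<omega> ^ m * h (S u \<omega>) * ennreal (exp (- l * (S s \<omega> - S u \<omega>))) \<partial>M)"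
  proof (rule nn_integral_dominated_convergence[where w="\<lambda>_. ennreal u ^ m"])
    show "AE \<omega> in M. grid_A q n u \<omega> ^ m * h (S u \<omega>) * ennreal (exp (- l * (S s \<omega> - S u \<omega>))) \<le> ennreal u ^ m" for n
      using mult_mono[OF b1 le] by (intro AE_I2) simp
    show "AE \<omega> in M. (\<lambda>n. grid_A q n u \<omega> ^ m * h (S u \<omega>) * ennreal (exp (- l * (S s \<omega> - S u \<omega>)))) \<longlonglongrightarrow>
       A q u \<omega> ^ m * h (S u \<omega>) * ennreal (exp (- l * (S s \<omega> - S u \<omega>)))"
      using hfin Apfin by (intro AE_I2 tendsto_mult_ennreal[OF lim tendsto_const]) (auto simp: ennreal_mult_eq_top_iff)
  qed (use fin in auto)
  have 3: "(\<lambda>n. (\<integral>\<^sup>+\<omega>. grid_A q n u \<omega> ^ m * h (S u \<omega>) \<partial>M) * ennreal (exp (- (s - u) * l powr \<alpha>))) \<longlonglongrightarrow>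
     (\<integral>\<^sup>+\<omega>. A q u \<omega> ^ m * h (S u \<omega>) \<partial>M) * ennreal (exp (- (s - u) * l powr \<alpha>))"
    by (intro tendsto_mult_ennreal 1 tendsto_const) auto
  show ?thesis
    using 2 3 unfolding grid_factorisation[OF assms(1) u assms(3-5)] by (rule LIMSEQ_unique)
qed

end

section \<open>The potential recursion and the moments of the time integral\<close>

context regular_stable_subordinator begin

sublocale pair_sigma_finite M lborel ..

text \<open>The Markov property at time \<open>u\<close>: writing the negative power as a Gamma mixture of
  exponentials, the future contributes only through the Laplace transform of its increments.\<close>

lemma future_potential:
  assumes "0 \<le> q" "0 \<le> u" "\<alpha> < p"
    and [measurable]: "h \<in> borel_measurable borel" and h: "\<And>x. 0 \<le> x \<Longrightarrow> h x \<le> 1"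
  shows "(\<integral>\<^sup>+s. indicator {u..} s * (\<integral>\<^sup>+\<omega>. A q u \<omega> ^ m * h (S u \<omega>) * pow p (S s \<omega>) \<partial>M) \<partial>lborel)
    = ennreal (Gamma (p - \<alpha>) / Gamma p) * (\<integral>\<^sup>+\<omega>. A q u \<omega> ^ m * h (S u \<omega>) * pow (p - \<alpha>) (S u \<omega>) \<partial>M)"
proof -
  define w where "w \<omega> = A q u \<omega> ^ m * h (S u \<omega>)" for \<omega>
  have [measurable]: "w \<in> borel_measurable M"
    unfolding w_def by measurable
  \<comment> \<open>The contribution of the past to the mixture at parameter \<open>l\<close>; it
    does not depend on the future time \<open>s\<close>, which makes the integration over
    \<open>s\<close> explicit.\<close>
  define E where "E l = (\<integral>\<^sup>+\<omega>. w \<omega> * ennreal (exp (- l * (1 + S u \<omega>))) \<partial>M)" for l :: real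
  have [measurable]: "E \<in> borel_measurable borel"
    unfolding E_def by measurable
  define g where "g r l = indicator {0..} l * ennreal (l powr (r - 1))" for r l :: real
  have [measurable]: "g r \<in> borel_measurable borel" for r
    unfolding g_def by measurable
  have p: "p > 0" "Gamma p > 0" "Gamma (p - \<alpha>) > 0"
    using assms \<alpha> by (auto intro!: Gamma_real_pos)
  have Gam: "ennreal (Gamma r) * pow r (S s \<omega>) = (\<integral>\<^sup>+l. g r l * ennreal (exp (- l * (1 + S s \<omega>))) \<partial>lborel)"
    if "r > 0" for r s \<omega>
  proof -
    have "(\<integral>\<^sup>+l. g r l * ennreal (exp (- l * (1 + S s \<omega>))) \<partial>lborel)
        = (\<integral>\<^sup>+l. indicator {0..} l * ennreal (l powr (r - 1) * exp (- l * (1 + S s \<omega>))) \<partial>lborel)"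
      by (intro nn_integral_cong) (simp add: g_def ennreal_mult mult.assoc)
    also have "\<dots> = ennreal (Gamma r * (1 + S s \<omega>) powr (- r))"
      using that S_nonneg[of s \<omega>] by (intro nn_integral_Gamma_kernel) auto
    finally show ?thesis
      using that by (simp add: pow_def ennreal_mult Gamma_real_pos less_imp_le)
  qed
  \<comment> \<open>The exponential at \<open>S s\<close> factors into one at \<open>S u\<close>,
    absorbed into the bounded function of \<open>S u\<close>, and one of the increment after
    \<open>u\<close>.\<close>
  have fac: "(\<integral>\<^sup>+\<omega>. w \<omega> * ennreal (exp (- l * (1 + S s \<omega>))) \<partial>M) = E l * ennreal (exp (- (s - u) * l powr \<alpha>))"
    if "u \<le> s" "0 \<le> l" for s l
  proof -
    let ?h = "\<lambda>x. h x * ennreal (exp (- l * (1 + x)))"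
    have "?h x \<le> 1" if "0 \<le> x" for x
      using mult_mono[OF h[OF that], of "ennreal (exp (- l * (1 + x)))" 1] that \<open>0 \<le> l\<close> by simp
    then have "(\<integral>\<^sup>+\<omega>. A q u \<omega> ^ m * ?h (S u \<omega>) * ennreal (exp (- l * (S s \<omega> - S u \<omega>))) \<partial>M)
      = (\<integral>\<^sup>+\<omega>. A q u \<omega> ^ m * ?h (S u \<omega>) \<partial>M) * ennreal (exp (- (s - u) * l powr \<alpha>))"
      using assms that by (intro factorisation) auto
    moreover have "A q u \<omega> ^ m * ?h (S u \<omega>) * ennreal (exp (- l * (S s \<omega> - S u \<omega>))) = w \<omega> * ennreal (exp (- l * (1 + S s \<omega>)))" for \<omega>
    proof -
      have "ennreal (exp (- l * (1 + S u \<omega>))) * ennreal (exp (- l * (S s \<omega> - S u \<omega>))) = ennreal (exp (- l * (1 + S s \<omega>)))"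
        by (simp add: ennreal_mult[symmetric] exp_add[symmetric] algebra_simps)
      then show ?thesis by (simp add: w_def mult.assoc)
    qed
    moreover have "(\<integral>\<^sup>+\<omega>. A q u \<omega> ^ m * ?h (S u \<omega>) \<partial>M) = E l"
      by (simp add: E_def w_def mult.assoc)
    ultimately show ?thesis by simp
  qed
  have inner: "ennreal (Gamma p) * (indicator {u..} s * (\<integral>\<^sup>+\<omega>. w \<omega> * pow p (S s \<omega>) \<partial>M))
      = (\<integral>\<^sup>+l. g p l * E l * (indicator {u..} s * ennreal (exp (- (s - u) * l powr \<alpha>))) \<partial>lborel)" for s
  proof (cases "u \<le> s")
    case True
    have "ennreal (Gamma p) * (\<integral>\<^sup>+\<omega>. w \<omega> * pow p (S s \<omega>) \<partial>M) = (\<integral>\<^sup>+\<omega>. w \<omega> * (ennreal (Gamma p) * pow p (S s \<omega>)) \<partial>M)"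
      by (subst nn_integral_cmult[symmetric]) (simp_all add: mult_ac)
    also have "\<dots> = (\<integral>\<^sup>+\<omega>. (\<integral>\<^sup>+l. w \<omega> * (g p l * ennreal (exp (- l * (1 + S s \<omega>)))) \<partial>lborel) \<partial>M)"
      unfolding Gam[OF p(1)] by (simp add: nn_integral_cmult)
    also have "\<dots> = (\<integral>\<^sup>+l. (\<integral>\<^sup>+\<omega>. w \<omega> * (g p l * ennreal (exp (- l * (1 + S s \<omega>)))) \<partial>M) \<partial>lborel)"
      by (rule Fubini'[symmetric]) measurable
    also have "\<dots> = (\<integral>\<^sup>+l. g p l * E l * ennreal (exp (- (s - u) * l powr \<alpha>)) \<partial>lborel)"
    proof (rule nn_integral_cong)
      fix l
      have "(\<integral>\<^sup>+\<omega>. w \<omega> * (g p l * ennreal (exp (- l * (1 + S s \<omega>)))) \<partial>M) = g p l * (\<integral>\<^sup>+\<omega>. w \<omega> * ennreal (exp (- l * (1 + S s \<omega>))) \<partial>M)"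
        by (subst nn_integral_cmult[symmetric]) (simp_all add: mult_ac)
      also have "\<dots> = g p l * (E l * ennreal (exp (- (s - u) * l powr \<alpha>)))"
        using fac[OF True, of l] by (cases "0 \<le> l") (simp_all add: g_def)
      finally show "(\<integral>\<^sup>+\<omega>. w \<omega> * (g p l * ennreal (exp (- l * (1 + S s \<omega>)))) \<partial>M) = g p l * E l * ennreal (exp (- (s - u) * l powr \<alpha>))"
        by (simp add: mult.assoc)
    qed
    finally show ?thesis using True by simp
  qed simp
  have "ennreal (Gamma p) * (\<integral>\<^sup>+s. indicator {u..} s * (\<integral>\<^sup>+\<omega>. w \<omega> * pow p (S s \<omega>) \<partial>M) \<partial>lborel)
      = (\<integral>\<^sup>+s. (\<integral>\<^sup>+l. g p l * E l * (indicator {u..} s * ennreal (exp (- (s - u) * l powr \<alpha>))) \<partial>lborel) \<partial>lborel)"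
    by (subst nn_integral_cmult[symmetric]) (simp_all add: inner)
  also have "\<dots> = (\<integral>\<^sup>+l. (\<integral>\<^sup>+s. g p l * E l * (indicator {u..} s * ennreal (exp (- (s - u) * l powr \<alpha>))) \<partial>lborel) \<partial>lborel)"
    by (rule lborel_pair.Fubini') measurable
  \<comment> \<open>The integral over \<open>s\<close> contributes
    \<open>1 / l powr \<alpha>\<close>, which turns the kernel of exponent \<open>p\<close> into
    that of exponent \<open>p - \<alpha>\<close>. From here on the mixture is undone.\<close>
  also have "\<dots> = (\<integral>\<^sup>+l. g (p - \<alpha>) l * E l \<partial>lborel)"
  proof (rule nn_integral_cong)
    fix l :: real
    show "(\<integral>\<^sup>+s. g p l * E l * (indicator {u..} s * ennreal (exp (- (s - u) * l powr \<alpha>))) \<partial>lborel) = g (p - \<alpha>) l * E l"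
    proof (cases "l > 0")
      case True
      have "(\<integral>\<^sup>+s. g p l * E l * (indicator {u..} s * ennreal (exp (- (s - u) * l powr \<alpha>))) \<partial>lborel)
        = g p l * E l * (\<integral>\<^sup>+s. indicator {u..} s * ennreal (exp (- (s - u) * l powr \<alpha>)) \<partial>lborel)"
        by (rule nn_integral_cmult) measurable
      also have "(\<integral>\<^sup>+s. indicator {u..} s * ennreal (exp (- (s - u) * l powr \<alpha>)) \<partial>lborel) = ennreal (1 / l powr \<alpha>)"
        using True by (intro nn_integral_exp_shifted) simp
      also have "g p l * E l * ennreal (1 / l powr \<alpha>) = (g p l * ennreal (1 / l powr \<alpha>)) * E l"
        by (simp add: mult_ac)
      also have "g p l * ennreal (1 / l powr \<alpha>) = g (p - \<alpha>) l"
      proof -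
        have "l powr (p - 1) * (1 / l powr \<alpha>) = l powr (p - \<alpha> - 1)"
          using powr_diff[of l "p - 1" \<alpha>] by (simp add: algebra_simps)
        then show ?thesis
          using True by (simp add: g_def flip: ennreal_mult)
      qed
      finally show ?thesis .
    qed (auto simp: g_def split: split_indicator)
  qed
  also have "\<dots> = (\<integral>\<^sup>+l. (\<integral>\<^sup>+\<omega>. w \<omega> * (g (p - \<alpha>) l * ennreal (exp (- l * (1 + S u \<omega>)))) \<partial>M) \<partial>lborel)"
    unfolding E_def by (subst nn_integral_cmult[symmetric]) (simp_all add: mult_ac)
  also have "\<dots> = (\<integral>\<^sup>+\<omega>. (\<integral>\<^sup>+l. w \<omega> * (g (p - \<alpha>) l * ennreal (exp (- l * (1 + S u \<omega>)))) \<partial>lborel) \<partial>M)"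
    by (rule Fubini') measurable
  also have "\<dots> = (\<integral>\<^sup>+\<omega>. w \<omega> * (ennreal (Gamma (p - \<alpha>)) * pow (p - \<alpha>) (S u \<omega>)) \<partial>M)"
    using assms by (subst Gam) (simp_all add: nn_integral_cmult)
  also have "\<dots> = ennreal (Gamma (p - \<alpha>)) * (\<integral>\<^sup>+\<omega>. w \<omega> * pow (p - \<alpha>) (S u \<omega>) \<partial>M)"
    by (subst nn_integral_cmult[symmetric]) (simp_all add: mult_ac)
  finally have eq: "ennreal (Gamma p) * (\<integral>\<^sup>+s. indicator {u..} s * (\<integral>\<^sup>+\<omega>. w \<omega> * pow p (S s \<omega>) \<partial>M) \<partial>lborel)
    = ennreal (Gamma (p - \<alpha>)) * (\<integral>\<^sup>+\<omega>. w \<omega> * pow (p - \<alpha>) (S u \<omega>) \<partial>M)" .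
  have "ennreal (1 / Gamma p) * (ennreal (Gamma p) * x) = x" for x
    using p(2) by (simp flip: mult.assoc ennreal_mult)
  then have "(\<integral>\<^sup>+s. indicator {u..} s * (\<integral>\<^sup>+\<omega>. w \<omega> * pow p (S s \<omega>) \<partial>M) \<partial>lborel)
    = ennreal (1 / Gamma p) * (ennreal (Gamma (p - \<alpha>)) * (\<integral>\<^sup>+\<omega>. w \<omega> * pow (p - \<alpha>) (S u \<omega>) \<partial>M))"
    by (simp flip: eq)
  also have "\<dots> = ennreal (Gamma (p - \<alpha>) / Gamma p) * (\<integral>\<^sup>+\<omega>. w \<omega> * pow (p - \<alpha>) (S u \<omega>) \<partial>M)"
    using p by (simp flip: mult.assoc ennreal_mult)
  finally show ?thesis
    unfolding w_def .
qed

text \<open>This is \<open>G(m, p)\<close> of the overview: \<open>q\<close> is tied to the path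
  integral, and only \<open>p\<close> moves in the recursion.\<close>

definition potential :: "real \<Rightarrow> nat \<Rightarrow> real \<Rightarrow> ennreal" where
  "potential q m p = (\<integral>\<^sup>+\<omega>. (\<integral>\<^sup>+s. indicator {0..} s * (A q s \<omega> ^ m * pow p (S s \<omega>)) \<partial>lborel) \<partial>M)"

lemma potential_0:
  assumes "\<alpha> < p"
  shows "potential q 0 p = ennreal (Gamma (p - \<alpha>) / Gamma p)"
proof -
  have "potential q 0 p = (\<integral>\<^sup>+s. (\<integral>\<^sup>+\<omega>. indicator {0..} s * pow p (S s \<omega>) \<partial>M) \<partial>lborel)"
    unfolding potential_def by (simp, rule Fubini'[symmetric]) measurable
  \<comment> \<open>The factors \<open>A 0 0 \<omega> ^ 0\<close> and \<open>1\<close> are neutral;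
    they bring the integrand into the shape of \<open>future_potential\<close> at time 0.\<close>
  also have "\<dots> = (\<integral>\<^sup>+s. indicator {0..} s * (\<integral>\<^sup>+\<omega>. A 0 0 \<omega> ^ 0 * 1 * pow p (S s \<omega>) \<partial>M) \<partial>lborel)"
    by (simp add: nn_integral_cmult)
  also have "\<dots> = ennreal (Gamma (p - \<alpha>) / Gamma p) * (\<integral>\<^sup>+\<omega>. A 0 0 \<omega> ^ 0 * 1 * pow (p - \<alpha>) (S 0 \<omega>) \<partial>M)"
    using assms by (intro future_potential) auto
  also have "\<dots> = ennreal (Gamma (p - \<alpha>) / Gamma p)"
    by (simp add: S_nonpos pow_def emeasure_space_1)
  finally show ?thesis .
qed

text \<open>After the power is expanded, the integrations are reordered so that \<open>u\<close> is
  outermost and \<open>s\<close> runs over \<open>{u..}\<close>. The Markov step applies with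
  \<open>h = pow q\<close>, and the two powers of \<open>1 + S u\<close> combine to the exponent
  \<open>q + p - \<alpha>\<close>.\<close>

lemma potential_Suc:
  assumes "0 \<le> q" "\<alpha> < p"
  shows "potential q (Suc m) p = of_nat (Suc m) * ennreal (Gamma (p - \<alpha>) / Gamma p) * potential q m (q + p - \<alpha>)"
proof -
  define F where "F u s \<omega> = indicator {0..} u * (indicator {u..} s * (A q u \<omega> ^ m * pow q (S u \<omega>) * pow p (S s \<omega>)))" for u s \<omega>
  have F_meas [measurable (raw)]: "(\<lambda>x. F (f x) (g x) (h x)) \<in> borel_measurable N"
    if [measurable]: "f \<in> borel_measurable N" "g \<in> borel_measurable N" "h \<in> N \<rightarrow>\<^sub>M M" for f g h and N :: "'b measure"
    unfolding F_def indicator_def atLeast_iff by measurable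
  have A: "indicator {0..} s * (A q s \<omega> ^ Suc m * pow p (S s \<omega>)) = of_nat (Suc m) * (\<integral>\<^sup>+u. F u s \<omega> \<partial>lborel)"
    if [measurable]: "\<omega> \<in> space M" for s \<omega>
  proof -
    have "A q s \<omega> ^ Suc m = of_nat (Suc m) * (\<integral>\<^sup>+u. indicator {0..} u * pow q (S u \<omega>) * indicator {..s} u * A q u \<omega> ^ m \<partial>lborel)"
      unfolding A_def by (rule nn_integral_power_Suc_atMost) measurable
    then have "indicator {0..} s * (A q s \<omega> ^ Suc m * pow p (S s \<omega>))
       = of_nat (Suc m) * ((indicator {0..} s * pow p (S s \<omega>)) * (\<integral>\<^sup>+u. indicator {0..} u * pow q (S u \<omega>) * indicator {..s} u * A q u \<omega> ^ m \<partial>lborel))"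
      by (simp add: mult_ac)
    also have "(indicator {0..} s * pow p (S s \<omega>)) * (\<integral>\<^sup>+u. indicator {0..} u * pow q (S u \<omega>) * indicator {..s} u * A q u \<omega> ^ m \<partial>lborel)
      = (\<integral>\<^sup>+u. (indicator {0..} s * pow p (S s \<omega>)) * (indicator {0..} u * pow q (S u \<omega>) * indicator {..s} u * A q u \<omega> ^ m) \<partial>lborel)"
      by (rule nn_integral_cmult[symmetric]) measurable
    also have "\<dots> = (\<integral>\<^sup>+u. F u s \<omega> \<partial>lborel)"
      by (intro nn_integral_cong) (auto simp: F_def mult_ac split: split_indicator)
    finally show ?thesis .
  qed
  have "potential q (Suc m) p = (\<integral>\<^sup>+\<omega>. (\<integral>\<^sup>+s. of_nat (Suc m) * (\<integral>\<^sup>+u. F u s \<omega> \<partial>lborel) \<partial>lborel) \<partial>M)"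
    unfolding potential_def by (intro nn_integral_cong A)
  also have "\<dots> = of_nat (Suc m) * (\<integral>\<^sup>+\<omega>. (\<integral>\<^sup>+s. (\<integral>\<^sup>+u. F u s \<omega> \<partial>lborel) \<partial>lborel) \<partial>M)"
  proof -
    have "(\<integral>\<^sup>+\<omega>. (\<integral>\<^sup>+s. of_nat (Suc m) * (\<integral>\<^sup>+u. F u s \<omega> \<partial>lborel) \<partial>lborel) \<partial>M)
        = (\<integral>\<^sup>+\<omega>. of_nat (Suc m) * (\<integral>\<^sup>+s. (\<integral>\<^sup>+u. F u s \<omega> \<partial>lborel) \<partial>lborel) \<partial>M)"
      by (intro nn_integral_cong nn_integral_cmult) measurable
    also have "\<dots> = of_nat (Suc m) * (\<integral>\<^sup>+\<omega>. (\<integral>\<^sup>+s. (\<integral>\<^sup>+u. F u s \<omega> \<partial>lborel) \<partial>lborel) \<partial>M)"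
      by (rule nn_integral_cmult) measurable
    finally show ?thesis .
  qed
  also have "(\<integral>\<^sup>+\<omega>. (\<integral>\<^sup>+s. (\<integral>\<^sup>+u. F u s \<omega> \<partial>lborel) \<partial>lborel) \<partial>M) = (\<integral>\<^sup>+\<omega>. (\<integral>\<^sup>+u. (\<integral>\<^sup>+s. F u s \<omega> \<partial>lborel) \<partial>lborel) \<partial>M)"
    by (intro nn_integral_cong lborel_pair.Fubini') measurable
  also have "\<dots> = (\<integral>\<^sup>+u. (\<integral>\<^sup>+\<omega>. (\<integral>\<^sup>+s. F u s \<omega> \<partial>lborel) \<partial>M) \<partial>lborel)"
    by (rule Fubini'[symmetric]) measurable
  also have "\<dots> = (\<integral>\<^sup>+u. (\<integral>\<^sup>+s. (\<integral>\<^sup>+\<omega>. F u s \<omega> \<partial>M) \<partial>lborel) \<partial>lborel)"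
    by (intro nn_integral_cong Fubini'[symmetric]) measurable
  also have "\<dots> = (\<integral>\<^sup>+u. indicator {0..} u * (ennreal (Gamma (p - \<alpha>) / Gamma p) * (\<integral>\<^sup>+\<omega>. A q u \<omega> ^ m * pow q (S u \<omega>) * pow (p - \<alpha>) (S u \<omega>) \<partial>M)) \<partial>lborel)"
  proof (rule nn_integral_cong)
    fix u :: real
    have "(\<integral>\<^sup>+s. (\<integral>\<^sup>+\<omega>. F u s \<omega> \<partial>M) \<partial>lborel) = indicator {0..} u * (\<integral>\<^sup>+s. indicator {u..} s * (\<integral>\<^sup>+\<omega>. A q u \<omega> ^ m * pow q (S u \<omega>) * pow p (S s \<omega>) \<partial>M) \<partial>lborel)"
      unfolding F_def by (simp add: nn_integral_cmult)
    also have "\<dots> = indicator {0..} u * (ennreal (Gamma (p - \<alpha>) / Gamma p) * (\<integral>\<^sup>+\<omega>. A q u \<omega> ^ m * pow q (S u \<omega>) * pow (p - \<alpha>) (S u \<omega>) \<partial>M))"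
      using assms by (cases "0 \<le> u") (simp_all add: future_potential pow_le_1)
    finally show "(\<integral>\<^sup>+s. (\<integral>\<^sup>+\<omega>. F u s \<omega> \<partial>M) \<partial>lborel) = \<dots>" .
  qed
  also have "\<dots> = ennreal (Gamma (p - \<alpha>) / Gamma p) * (\<integral>\<^sup>+u. (\<integral>\<^sup>+\<omega>. indicator {0..} u * (A q u \<omega> ^ m * pow (q + p - \<alpha>) (S u \<omega>)) \<partial>M) \<partial>lborel)"
  proof -
    have "pow q (S u \<omega>) * pow (p - \<alpha>) (S u \<omega>) = pow (q + p - \<alpha>) (S u \<omega>)" for u \<omega>
      using S_nonneg[of u \<omega>] by (simp add: pow_def flip: ennreal_mult powr_add) (simp add: algebra_simps)
    then have "A q u \<omega> ^ m * pow q (S u \<omega>) * pow (p - \<alpha>) (S u \<omega>) = A q u \<omega> ^ m * pow (q + p - \<alpha>) (S u \<omega>)" for u \<omega>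
      by (simp only: mult.assoc)
    moreover have "(\<integral>\<^sup>+\<omega>. indicator {0..} u * (A q u \<omega> ^ m * pow (q + p - \<alpha>) (S u \<omega>)) \<partial>M)
        = indicator {0..} u * (\<integral>\<^sup>+\<omega>. A q u \<omega> ^ m * pow (q + p - \<alpha>) (S u \<omega>) \<partial>M)" for u
      by (rule nn_integral_cmult) measurable
    ultimately show ?thesis
      by (simp only: mult.left_commute[of "indicator {0..} _" "ennreal _"]) (rule nn_integral_cmult, measurable)
  qed
  also have "(\<integral>\<^sup>+u. (\<integral>\<^sup>+\<omega>. indicator {0..} u * (A q u \<omega> ^ m * pow (q + p - \<alpha>) (S u \<omega>)) \<partial>M) \<partial>lborel) = potential q m (q + p - \<alpha>)"
    unfolding potential_def by (rule Fubini') measurable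
  finally show ?thesis by (simp add: mult.assoc)
qed

text \<open>Passing from \<open>p\<close> to \<open>q + p - \<alpha>\<close> replaces each factor by
  the one with the next index, and the recursion supplies the missing factor at index 0. Hence the
  induction runs over all \<open>p\<close> at once.\<close>

lemma potential_eq:
  assumes "\<alpha> < q" "\<alpha> < p"
  shows "potential q m p = ennreal (fact m * (\<Prod>k<Suc m. Gamma (p - \<alpha> + real k * (q - \<alpha>)) / Gamma (p + real k * (q - \<alpha>))))"
  using assms(2)
proof (induction m arbitrary: p)
  case 0
  then show ?case by (simp add: potential_0)
next
  case (Suc m)
  let ?b = "q - \<alpha>"
  let ?f = "\<lambda>p k. Gamma (p - \<alpha> + real k * ?b) / Gamma (p + real k * ?b)"
  have pos: "0 \<le> ?f p k" if "\<alpha> < p" for p k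
  proof -
    have "0 \<le> real k * ?b" using assms by simp
    then show ?thesis
      using that \<alpha> by (intro divide_nonneg_nonneg less_imp_le[OF Gamma_real_pos]) linarith+
  qed
  have p': "\<alpha> < q + p - \<alpha>" using Suc.prems assms \<alpha> by simp
  have shift: "?f (q + p - \<alpha>) k = ?f p (Suc k)" for k
    by (simp add: algebra_simps)
  have "potential q (Suc m) p = of_nat (Suc m) * ennreal (?f p 0) * ennreal (fact m * (\<Prod>k<Suc m. ?f p (Suc k)))"
    using potential_Suc[of q p m] Suc.prems assms(1) \<alpha> unfolding Suc.IH[OF p'] shift by simp
  also have "\<dots> = ennreal (real (Suc m) * ?f p 0 * (fact m * (\<Prod>k<Suc m. ?f p (Suc k))))"
    using pos[OF Suc.prems] 
    by (simp only: ennreal_of_nat_eq_real_of_nat ennreal_mult[symmetric] of_nat_0_le_iff mult_nonneg_nonneg fact_ge_zero prod_nonneg)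
  also have "real (Suc m) * ?f p 0 * (fact m * (\<Prod>k<Suc m. ?f p (Suc k))) = fact (Suc m) * (\<Prod>k<Suc (Suc m). ?f p k)"
    by (subst prod.lessThan_Suc_shift[of _ "Suc m"]) (simp add: mult_ac del: prod.lessThan_Suc)
  finally show ?case .
qed

definition total :: "real \<Rightarrow> 'a \<Rightarrow> ennreal" where
  "total q \<omega> = (\<integral>\<^sup>+t. indicator {0..} t * pow q (S t \<omega>) \<partial>lborel)"

lemma measurable_total [measurable]: "total q \<in> borel_measurable M"
  unfolding total_def by measurable

lemma nn_integral_total_power:
  assumes "\<alpha> < q"
  shows "(\<integral>\<^sup>+\<omega>. total q \<omega> ^ n \<partial>M) = ennreal (limit_moment \<alpha> (q - \<alpha>) n)"
proof (cases n)
  case 0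
  then show ?thesis by (simp add: limit_moment_def emeasure_space_1)
next
  case (Suc m)
  have "(\<integral>\<^sup>+\<omega>. total q \<omega> ^ Suc m \<partial>M) = (\<integral>\<^sup>+\<omega>. of_nat (Suc m) * (\<integral>\<^sup>+u. indicator {0..} u * (A q u \<omega> ^ m * pow q (S u \<omega>)) \<partial>lborel) \<partial>M)"
  proof (rule nn_integral_cong)
    fix \<omega> assume [measurable]: "\<omega> \<in> space M"
    have "total q \<omega> ^ Suc m = of_nat (Suc m) * (\<integral>\<^sup>+u. indicator {0..} u * pow q (S u \<omega>) * A q u \<omega> ^ m \<partial>lborel)"
      unfolding total_def A_def by (rule nn_integral_power_Suc) measurable
    then show "total q \<omega> ^ Suc m = of_nat (Suc m) * (\<integral>\<^sup>+u. indicator {0..} u * (A q u \<omega> ^ m * pow q (S u \<omega>)) \<partial>lborel)"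
      by (simp add: mult_ac)
  qed
  also have "\<dots> = of_nat (Suc m) * potential q m q"
    unfolding potential_def by (rule nn_integral_cmult) measurable
  also have "\<dots> = ennreal (real (Suc m) * (fact m * (\<Prod>k<Suc m. Gamma (q - \<alpha> + real k * (q - \<alpha>)) / Gamma (q + real k * (q - \<alpha>)))))"
    using assms by (simp only: potential_eq ennreal_of_nat_eq_real_of_nat ennreal_mult'[symmetric] of_nat_0_le_iff)
  also have "real (Suc m) * (fact m * (\<Prod>k<Suc m. Gamma (q - \<alpha> + real k * (q - \<alpha>)) / Gamma (q + real k * (q - \<alpha>)))) = limit_moment \<alpha> (q - \<alpha>) (Suc m)"
  proof -
    have "q - \<alpha> + real k * (q - \<alpha>) = real (Suc k) * (q - \<alpha>)" "q + real k * (q - \<alpha>) = real (Suc k) * (q - \<alpha>) + \<alpha>" for k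
      by (simp_all add: algebra_simps)
    then show ?thesis
      by (simp add: limit_moment_def mult_ac del: prod.lessThan_Suc of_nat_Suc)
  qed
  finally show ?thesis by (simp add: Suc)
qed

end

section \<open>Identification of the laws\<close>

text \<open>The preimages under \<open>f\<close> and \<open>g\<close> differ only inside the set
  where the two functions disagree; it lies in a null set, so all its subsets are measurable in the
  completion. This handles the integral along the original paths.\<close>

lemma measurable_completion_AE:
  assumes [measurable]: "g \<in> M \<rightarrow>\<^sub>M N" and eq: "AE x in M. f x = g x" and f: "f \<in> space M \<rightarrow> space N"
  shows "f \<in> completion M \<rightarrow>\<^sub>M N"
proof (rule measurableI)
  fix B assume [measurable]: "B \<in> sets N"
  have neq [measurable]: "Measurable.pred (completion M) (\<lambda>x. f x \<noteq> g x)" "Measurable.pred (completion M) (\<lambda>x. f x \<noteq> g x \<and> f x \<in> B)"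
    using eq by (auto intro!: sets_completion_AE elim: eventually_mono)
  have [measurable]: "g \<in> completion M \<rightarrow>\<^sub>M N"
    by (intro measurable_completion assms)
  have "Measurable.pred (completion M) (\<lambda>x. (\<not> f x \<noteq> g x \<and> g x \<in> B) \<or> (f x \<noteq> g x \<and> f x \<in> B))"
    by measurable
  also have "(\<lambda>x. (\<not> f x \<noteq> g x \<and> g x \<in> B) \<or> (f x \<noteq> g x \<and> f x \<in> B)) = (\<lambda>x. f x \<in> B)"
    by auto
  finally show "f -` B \<inter> space (completion M) \<in> sets (completion M)"
    by (simp add: pred_def vimage_def Int_def conj_commute)
qed (use f in auto)

lemma distr_completion_AE:
  assumes g: "g \<in> M \<rightarrow>\<^sub>M N" and eq: "AE x in M. f x = g x" and f: "f \<in> space M \<rightarrow> space N"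
  shows "distr (completion M) N f = distr M N g"
proof -
  have "distr (completion M) N f = distr (completion M) N g"
    using assms by (intro distr_cong_AE measurable_completion_AE[OF assms] measurable_completion AE_completion) auto
  then show ?thesis using g by (simp add: distr_completion)
qed

text \<open>The exceptional paths are gathered in one null set \<open>N\<close> and replaced by 0;
  the others keep their value at time 0 on negative times. The Laplace transform of an increment
  follows from stationarity and the start at zero.\<close>

lemma stable_subordinator_regular_version:
  assumes \<alpha>: "0 < \<alpha>" "\<alpha> < 1" and st: "stable_subordinator M \<alpha> \<sigma>"
  obtains S where "regular_stable_subordinator M \<alpha> S" "AE \<omega> in M. \<forall>t\<ge>0. S t \<omega> = \<sigma> t \<omega>"
proof -
  have sub: "subordinator M \<sigma>"
    and lap: "\<And>t l. 0 \<le> t \<Longrightarrow> 0 \<le> l \<Longrightarrow> (\<integral>\<omega>. exp (- l * \<sigma> t \<omega>) \<partial>M) = exp (- t * l powr \<alpha>)"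
    using st by (auto simp: stable_subordinator_def)
  interpret prob_space M using sub by (simp add: subordinator_def)
  have meas: "\<And>t. 0 \<le> t \<Longrightarrow> \<sigma> t \<in> borel_measurable M"
    and zero: "AE \<omega> in M. \<sigma> 0 \<omega> = 0"
    and ind: "\<And>(n::nat) t. 0 \<le> t 0 \<Longrightarrow> (\<And>i. i < n \<Longrightarrow> t i \<le> t (Suc i)) \<Longrightarrow>
        indep_vars (\<lambda>_. borel) (\<lambda>i \<omega>. \<sigma> (t (Suc i)) \<omega> - \<sigma> (t i) \<omega>) {..<n}"
    and stat: "\<And>s t. 0 \<le> s \<Longrightarrow> 0 \<le> t \<Longrightarrow> distr M borel (\<lambda>\<omega>. \<sigma> (s + t) \<omega> - \<sigma> s \<omega>) = distr M borel (\<lambda>\<omega>. \<sigma> t \<omega> - \<sigma> 0 \<omega>)"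
    and path: "AE \<omega> in M. mono_on {0..} (\<lambda>t. \<sigma> t \<omega>) \<and> (\<forall>t\<ge>0. continuous (at_right t) (\<lambda>s. \<sigma> s \<omega>))"
    using sub by (auto simp: subordinator_def)
  have "AE \<omega> in M. \<sigma> 0 \<omega> = 0 \<and> mono_on {0..} (\<lambda>t. \<sigma> t \<omega>) \<and> (\<forall>t\<ge>0. continuous (at_right t) (\<lambda>s. \<sigma> s \<omega>))"
    using zero path by eventually_elim auto
  then obtain N where N: "N \<in> null_sets M"
    and good: "\<And>\<omega>. \<omega> \<in> space M - N \<Longrightarrow> \<sigma> 0 \<omega> = 0 \<and> mono_on {0..} (\<lambda>t. \<sigma> t \<omega>) \<and> (\<forall>t\<ge>0. continuous (at_right t) (\<lambda>s. \<sigma> s \<omega>))"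
    by (rule AE_E3) auto
  define S where "S t \<omega> = (if \<omega> \<in> space M - N then \<sigma> (max t 0) \<omega> else 0)" for t \<omega>
  have [measurable]: "N \<in> sets M" using N by auto
  have eq: "AE \<omega> in M. \<forall>t\<ge>0. S t \<omega> = \<sigma> t \<omega>"
    using AE_not_in[OF N] AE_space by eventually_elim (auto simp: S_def)
  have measS: "S t \<in> borel_measurable M" for t
    unfolding S_def using meas[of "max t 0"] by measurable
  \<comment> \<open>Nonnegativity bounds the exponentials by 1, so they are integrable and the given
    expectation can be read as a nonnegative integral.\<close>
  have nn: "AE \<omega> in M. 0 \<le> \<sigma> t \<omega>" if "0 \<le> t" for t
    using AE_not_in[OF N] AE_space
  proof eventually_elim
    case (elim \<omega>)
    with good[of \<omega>] that mono_onD[of "{0..}" "\<lambda>t. \<sigma> t \<omega>" 0 t] show ?case by auto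
  qed
  have "regular_stable_subordinator M \<alpha> S"
  proof
    show "S t \<omega> = 0" if "t \<le> 0" for t \<omega>
      using that good[of \<omega>] by (auto simp: S_def max_def)
    show "mono (\<lambda>t. S t \<omega>)" for \<omega>
    proof (rule monoI)
      fix s t :: real assume "s \<le> t"
      then show "S s \<omega> \<le> S t \<omega>"
        using good[of \<omega>] mono_onD[of "{0..}" "\<lambda>t. \<sigma> t \<omega>" "max s 0" "max t 0"] by (auto simp: S_def)
    qed
    show "continuous (at_right t) (\<lambda>s. S s \<omega>)" for t \<omega>
    proof (cases "\<omega> \<in> space M - N")
      case True
      show ?thesis
      proof (cases "t \<ge> 0")
        case t: True
        then have "((\<lambda>s. \<sigma> s \<omega>) \<longlongrightarrow> \<sigma> t \<omega>) (at_right t)"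
          using good[OF True] by (simp add: continuous_within)
        moreover have "\<forall>\<^sub>F s in at_right t. \<sigma> s \<omega> = S s \<omega>"
          using t True by (auto simp: S_def eventually_at_filter)
        ultimately have "((\<lambda>s. S s \<omega>) \<longlongrightarrow> \<sigma> t \<omega>) (at_right t)"
          by (rule Lim_transform_eventually)
        then show ?thesis
          using t True by (simp add: continuous_within S_def)
      next
        case False
        then have "\<forall>\<^sub>F s in at_right t. \<sigma> 0 \<omega> = S s \<omega>"
          using True by (intro eventually_at_rightI[of t 0]) (auto simp: S_def)
        then have "((\<lambda>s. S s \<omega>) \<longlongrightarrow> \<sigma> 0 \<omega>) (at_right t)"
          by (rule Lim_transform_eventually[OF tendsto_const])
        then show ?thesis
          using False True by (simp add: continuous_within S_def)
      qed
    next
      case False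
      then have "(\<lambda>s. S s \<omega>) = (\<lambda>_. 0)" by (auto simp: S_def)
      then show ?thesis by simp
    qed
    show "indep_vars (\<lambda>_. borel) (\<lambda>i \<omega>. S (t (Suc i)) \<omega> - S (t i) \<omega>) {..<n}"
      if "0 \<le> t 0" "\<And>i. i < n \<Longrightarrow> t i \<le> t (Suc i)" for n :: nat and t
    proof (rule indep_vars_cong_AE[OF ind[of t n]])
      \<comment> \<open>Agreement of the two processes is available at nonnegative times only, so
        every time of the partition has to be nonnegative.\<close>
      have t0: "0 \<le> t i" if "i \<le> n" for i
        using that
      proof (induction i)
        case (Suc i)
        then show ?case using \<open>\<And>i. i < n \<Longrightarrow> t i \<le> t (Suc i)\<close>[of i] by simp
      qed (use \<open>0 \<le> t 0\<close> in simp)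
      fix i assume "i \<in> {..<n}"
      then have "0 \<le> t i" "0 \<le> t (Suc i)" using t0 by auto
      then show "AE \<omega> in M. \<sigma> (t (Suc i)) \<omega> - \<sigma> (t i) \<omega> = S (t (Suc i)) \<omega> - S (t i) \<omega>"
        using eq by (auto elim!: eventually_mono)
    qed (use that measS in \<open>auto intro!: borel_measurable_diff\<close>)
    show "(\<integral>\<^sup>+\<omega>. ennreal (exp (- l * (S s \<omega> - S u \<omega>))) \<partial>M) = ennreal (exp (- (s - u) * l powr \<alpha>))"
      if "0 \<le> u" "u \<le> s" "0 \<le> l" for u s l
    proof -
      note [measurable] = meas[OF that(1)] meas[of s] meas[of "s - u"] meas[of 0]
      have s: "0 \<le> s" "0 \<le> s - u" using that by auto
      have "(\<integral>\<^sup>+\<omega>. ennreal (exp (- l * (S s \<omega> - S u \<omega>))) \<partial>M) = (\<integral>\<^sup>+\<omega>. ennreal (exp (- l * (\<sigma> s \<omega> - \<sigma> u \<omega>))) \<partial>M)"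
      proof (rule nn_integral_cong_AE)
        show "AE \<omega> in M. ennreal (exp (- l * (S s \<omega> - S u \<omega>))) = ennreal (exp (- l * (\<sigma> s \<omega> - \<sigma> u \<omega>)))"
          using eq by eventually_elim (simp add: that(1) s)
      qed
      also have "\<dots> = (\<integral>\<^sup>+x. ennreal (exp (- l * x)) \<partial>distr M borel (\<lambda>\<omega>. \<sigma> s \<omega> - \<sigma> u \<omega>))"
        using s by (subst nn_integral_distr) auto
      also have "distr M borel (\<lambda>\<omega>. \<sigma> s \<omega> - \<sigma> u \<omega>) = distr M borel (\<lambda>\<omega>. \<sigma> (s - u) \<omega> - \<sigma> 0 \<omega>)"
        using stat[of u "s - u"] that by simp
      also have "(\<integral>\<^sup>+x. ennreal (exp (- l * x)) \<partial>distr M borel (\<lambda>\<omega>. \<sigma> (s - u) \<omega> - \<sigma> 0 \<omega>)) = (\<integral>\<^sup>+\<omega>. ennreal (exp (- l * (\<sigma> (s - u) \<omega> - \<sigma> 0 \<omega>))) \<partial>M)"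
        using s by (subst nn_integral_distr) auto
      also have "\<dots> = (\<integral>\<^sup>+\<omega>. ennreal (exp (- l * \<sigma> (s - u) \<omega>)) \<partial>M)"
      proof (rule nn_integral_cong_AE)
        show "AE \<omega> in M. ennreal (exp (- l * (\<sigma> (s - u) \<omega> - \<sigma> 0 \<omega>))) = ennreal (exp (- l * \<sigma> (s - u) \<omega>))"
          using zero by eventually_elim simp
      qed
      also have "\<dots> = ennreal (\<integral>\<omega>. exp (- l * \<sigma> (s - u) \<omega>) \<partial>M)"
      proof (rule nn_integral_eq_integral)
        show "integrable M (\<lambda>\<omega>. exp (- l * \<sigma> (s - u) \<omega>))"
          using nn[OF s(2)] that s by (intro integrable_const_bound[where B=1]) (auto elim!: eventually_mono)
      qed simp
      also have "\<dots> = ennreal (exp (- (s - u) * l powr \<alpha>))"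
        using lap[OF s(2) that(3)] by simp
      finally show ?thesis .
    qed
  qed (use \<alpha> measS in auto)
  with eq that show thesis by blast
qed

text \<open>Almost sure finiteness comes from the first moment. The moments are known exactly, so
  the expansion is applied to a constant sequence of variables.\<close>

lemma (in regular_stable_subordinator) char_total:
  assumes "\<alpha> < q"
  shows "AE \<omega> in M. total q \<omega> \<noteq> \<infinity>"
    and "(\<lambda>n. \<Sum>k\<le>n. (\<i> * of_real t) ^ k / fact k * of_real (limit_moment \<alpha> (q - \<alpha>) k)) \<longlonglongrightarrow>
      char (distr M borel (\<lambda>\<omega>. enn2real (total q \<omega>))) t"
proof -
  have lm: "0 \<le> limit_moment \<alpha> (q - \<alpha>) k" for k
    unfolding limit_moment_def using assms \<alpha>
    by (intro mult_nonneg_nonneg prod_nonneg divide_nonneg_nonneg less_imp_le[OF Gamma_real_pos] ballI) (auto intro!: add_nonneg_pos)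
  show fin: "AE \<omega> in M. total q \<omega> \<noteq> \<infinity>"
    using nn_integral_total_power[OF assms, of 1] by (intro nn_integral_PInf_AE) auto
  have "has_bochner_integral M (\<lambda>\<omega>. enn2real (total q \<omega>) ^ k) (limit_moment \<alpha> (q - \<alpha>) k)" for k
  proof (rule has_bochner_integral_nn_integral)
    have "(\<integral>\<^sup>+\<omega>. ennreal (enn2real (total q \<omega>) ^ k) \<partial>M) = (\<integral>\<^sup>+\<omega>. total q \<omega> ^ k \<partial>M)"
      using fin by (intro nn_integral_cong_AE) (auto elim!: eventually_mono simp: less_top simp flip: ennreal_power)
    then show "(\<integral>\<^sup>+\<omega>. ennreal (enn2real (total q \<omega>) ^ k) \<partial>M) = ennreal (limit_moment \<alpha> (q - \<alpha>) k)"
      using nn_integral_total_power[OF assms] by simp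
  qed (auto simp: lm)
  then have "integrable M (\<lambda>\<omega>. enn2real (total q \<omega>) ^ k)" "(\<integral>\<omega>. enn2real (total q \<omega>) ^ k \<partial>M) = limit_moment \<alpha> (q - \<alpha>) k" for k
    by (auto simp: has_bochner_integral_iff)
  then show "(\<lambda>n. \<Sum>k\<le>n. (\<i> * of_real t) ^ k / fact k * of_real (limit_moment \<alpha> (q - \<alpha>) k)) \<longlonglongrightarrow>
      char (distr M borel (\<lambda>\<omega>. enn2real (total q \<omega>))) t"
    using assms \<alpha>
    by (intro char_sums_moments[where X="\<lambda>_ \<omega>. enn2real (total q \<omega>)"] prob_space_axioms limit_moment_growth) auto
qed

text \<open>The scale factor cancels the powers of \<open>Gamma q / Gamma (q - \<alpha>)\<close> in
  the limits of the moments, which leaves the same series as for the time integral.\<close>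

lemma char_scaled_beta_product:
  fixes \<alpha> q :: real
  assumes \<alpha>: "0 < \<alpha>" "\<alpha> < 1" and q: "\<alpha> < q"
  defines "a \<equiv> q / (q - \<alpha>)" and "b \<equiv> 1 / (q - \<alpha>)" and "c \<equiv> (1 - \<alpha>) / (q - \<alpha>)"
  shows "(\<lambda>n. \<Sum>k\<le>n. (\<i> * of_real t) ^ k / fact k * of_real (limit_moment \<alpha> (q - \<alpha>) k)) \<longlonglongrightarrow>
      char (distr (beta_space a b c) borel (\<lambda>\<omega>. Gamma (q - \<alpha>) / Gamma q * beta_product a b c \<omega>)) t"
proof -
  define r where "r = Gamma (q - \<alpha>) / Gamma q"
  have G: "Gamma q > 0" "Gamma (q - \<alpha>) > 0" using \<alpha> q by (auto intro!: Gamma_real_pos)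
  then have r: "r > 0" by (simp add: r_def)
  interpret beta_factors a b c
    using \<alpha> q by unfold_locales (auto simp: a_def b_def c_def)
  have "(\<integral>\<omega>. (r * partial N \<omega>) ^ k \<partial>S) = r ^ k * (\<Prod>n<N. factor_moment n k)"
    and int: "integrable S (\<lambda>\<omega>. (r * partial N \<omega>) ^ k)" for N k
    using has_bochner_integral_partial_power[of N k] by (auto simp: has_bochner_integral_iff power_mult_distrib)
  moreover have "(\<lambda>N. r ^ k * (\<Prod>n<N. factor_moment n k)) \<longlonglongrightarrow> r ^ k * ((Gamma q / Gamma (q - \<alpha>)) ^ k * limit_moment \<alpha> (q - \<alpha>) k)" for k
    unfolding a_def b_def c_def using \<alpha> q by (intro tendsto_mult tendsto_const tendsto_beta_product_moments)
  moreover have "r ^ k * ((Gamma q / Gamma (q - \<alpha>)) ^ k * limit_moment \<alpha> (q - \<alpha>) k) = limit_moment \<alpha> (q - \<alpha>) k" for k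
    using G by (simp add: r_def power_divide)
  ultimately have mom: "(\<lambda>N. \<integral>\<omega>. (r * partial N \<omega>) ^ k \<partial>S) \<longlonglongrightarrow> limit_moment \<alpha> (q - \<alpha>) k" for k
    by simp
  have "AE \<omega> in S. 0 \<le> r * partial N \<omega>" for N
    using AE_S
  proof eventually_elim
    case (elim \<omega>)
    then have "0 < partial N \<omega>" by (rule partial_ratio_le(1)[of \<omega> N N N N]) auto
    then show ?case using r by simp
  qed
  moreover have "AE \<omega> in S. (\<lambda>N. r * partial N \<omega>) \<longlonglongrightarrow> r * beta_product a b c \<omega>"
    using AE_partial_tendsto by eventually_elim (intro tendsto_intros)
  ultimately show ?thesis
    unfolding r_def[symmetric] using mom int \<alpha> q
    by (intro char_sums_moments[where X="\<lambda>N \<omega>. r * partial N \<omega>"] prob_space_S limit_moment_growth) auto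
qed

theorem corollary3:
  fixes \<alpha> q :: real and M :: "'a measure" and \<sigma> :: "real \<Rightarrow> 'a \<Rightarrow> real"
  assumes "0 < \<alpha>" and "\<alpha> < 1"
    and "stable_subordinator M \<alpha> \<sigma>"
    and "q > \<alpha>"
  shows "distr (completion M) borel (\<lambda>\<omega>. \<integral>\<^sup>+t\<in>{0..}. ennreal (1 / (1 + \<sigma> t \<omega>) powr q) \<partial>lborel) =
         distr (beta_space (q / (q - \<alpha>)) (1 / (q - \<alpha>)) ((1 - \<alpha>) / (q - \<alpha>))) borel
           (\<lambda>\<omega>. ennreal (Gamma (q - \<alpha>) / Gamma q *
              beta_product (q / (q - \<alpha>)) (1 / (q - \<alpha>)) ((1 - \<alpha>) / (q - \<alpha>)) \<omega>))"
proof -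
  obtain S where S: "regular_stable_subordinator M \<alpha> S" and eq: "AE \<omega> in M. \<forall>t\<ge>0. S t \<omega> = \<sigma> t \<omega>"
    using stable_subordinator_regular_version assms(1-3) by blast
  interpret regular_stable_subordinator M \<alpha> S by (rule S)
  let ?a = "q / (q - \<alpha>)" and ?b = "1 / (q - \<alpha>)" and ?c = "(1 - \<alpha>) / (q - \<alpha>)"
  let ?T = "\<lambda>\<omega>. Gamma (q - \<alpha>) / Gamma q * beta_product ?a ?b ?c \<omega>"
  interpret B: beta_factors ?a ?b ?c
    using assms by unfold_locales auto
  interpret BS: prob_space "beta_space ?a ?b ?c" by (rule B.prob_space_S)
  have "distr (completion M) borel (\<lambda>\<omega>. \<integral>\<^sup>+t\<in>{0..}. ennreal (1 / (1 + \<sigma> t \<omega>) powr q) \<partial>lborel) = distr M borel (total q)"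
  proof (rule distr_completion_AE)
    show "AE \<omega> in M. (\<integral>\<^sup>+t\<in>{0..}. ennreal (1 / (1 + \<sigma> t \<omega>) powr q) \<partial>lborel) = total q \<omega>"
      using eq
    proof eventually_elim
      case (elim \<omega>)
      then show ?case
        unfolding total_def
        by (intro nn_integral_cong) (auto simp: pow_def powr_minus_divide split: split_indicator)
    qed
  qed auto
  \<comment> \<open>Levy's theorem concerns laws on the reals; as the integral is almost surely
    finite, its law is the image under \<open>ennreal\<close> of a real law.\<close>
  also have "\<dots> = distr M borel (\<lambda>\<omega>. ennreal (enn2real (total q \<omega>)))"
    using char_total(1)[OF assms(4)] by (intro distr_cong_AE) (auto elim!: eventually_mono simp: less_top)
  also have "\<dots> = distr (distr M borel (\<lambda>\<omega>. enn2real (total q \<omega>))) borel ennreal"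
    by (simp add: distr_distr comp_def)
  also have "distr M borel (\<lambda>\<omega>. enn2real (total q \<omega>)) = distr (beta_space ?a ?b ?c) borel ?T"
  proof (rule Levy_uniqueness)
    show "real_distribution (distr M borel (\<lambda>\<omega>. enn2real (total q \<omega>)))"
      by (rule real_distribution_distr) measurable
    show "real_distribution (distr (beta_space ?a ?b ?c) borel ?T)"
      by (rule BS.real_distribution_distr) measurable
    show "char (distr M borel (\<lambda>\<omega>. enn2real (total q \<omega>))) = char (distr (beta_space ?a ?b ?c) borel ?T)"
      using LIMSEQ_unique[OF char_total(2)[OF assms(4)] char_scaled_beta_product[OF assms(1,2,4)]] by blast
  qed
  also have "distr \<dots> borel ennreal = distr (beta_space ?a ?b ?c) borel (\<lambda>\<omega>. ennreal (?T \<omega>))"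
    by (simp add: distr_distr comp_def)
  finally show ?thesis .
qed

end
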